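(* (Von Nägelsbach-Kostka identity, or dual Jacobi-Trudi identity.) Let $\lambda,\mu\in\mathcal P$ with $\mu_i\le\lambda_i$ for all $i\in\mathbf N$, and let $r\in\mathbf N$ be such that $\lambda_0\le r$. Then $$ s_{\lambda/\mu}=\det\bigl(e_{\lambda^t[i]-\mu^t[j]}\bigr)_{0\le i,j<r}. $$
   Context: $\mathbf N=\{0,1,2,\ldots\}$. A composition is a finitely supported sequence $\alpha=(\alpha_i)_{i\in\mathbf N}$ of natural numbers; $\mathcal C$ is the set of all compositions, and $\mathcal P\subset\mathcal C$ is the set of partitions, i.e. weakly decreasing compositions; $\lambda^t$ is the transpose partition, $\lambda^t_j=\#\{i: j<\lambda_i\}$. Finite vectors are extended by zeros, so $\mathbf N^n\subset\mathcal C$. For $\alpha\in\mathcal C$ and $i\in\mathbf N$, $\alpha[i]=\alpha_i-1-i\in\mathbf Z$. $\Lambda$ is the ring of symmetric functions over $\mathbf Z$ (symmetric power series of bounded degree in indeterminates $X_i$, $i\in\mathbf N$). For $d\in\mathbf N$, $e_d=\sum_{i_1<\cdots<i_d}X_{i_1}\cdots X_{i_d}$ (so $e_0=1$), and $e_d=0$ for $d<0$. Schur functions: for $\alpha\in\mathbf N^n$ put $a_\alpha[X_{[n]}]=\sum_{\sigma\in\mathbf S_n}\operatorname{sgn}(\sigma)\prod_{i=0}^{n-1}X_{\sigma(i)}^{\alpha_i}$, let $\delta_n=(n-1,\ldots,1,0)$, and set $s_\alpha[X_{[n]}]=a_{\delta_n+\alpha}[X_{[n]}]/a_{\delta_n}[X_{[n]}]$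 for $\alpha\in\mathbf N^n$ and $s_\alpha[X_{[n]}]=0$ for $\alpha\in\mathcal C\setminus\mathbf N^n$. Then $s_\alpha\in\Lambda$ is the unique symmetric function which for every $n$ becomes $s_\alpha[X_{[n]}]$ upon setting $X_i=0$ for all $i\ge n$. The set $\{s_\lambda:\lambda\in\mathcal P\}$ is a $\mathbf Z$-basis of $\Lambda$; $\langle\cdot,\cdot\rangle$ is the scalar product on $\Lambda$ for which this basis is orthonormal. The skew Schur function $s_{\lambda/\mu}$ is characterised by $\langle s_{\lambda/\mu},f\rangle=\langle s_\lambda,s_\mu f\rangle$ for all $f\in\Lambda$. *)

theory Defs
  imports
    "HOL-Library.Poly_Mapping"
    "HOL-Combinatorics.Permutations"
    "Jordan_Normal_Form.Determinant"
begin

section \<open>Compositions and partitions\<close>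

type_synonym composition = "nat \<Rightarrow>\<^sub>0 nat"

definition in_vec :: "nat \<Rightarrow> composition \<Rightarrow> bool" where
  "in_vec n \<alpha> \<longleftrightarrow> Poly_Mapping.keys \<alpha> \<subseteq> {..<n}"

definition is_partition :: "composition \<Rightarrow> bool" where
  "is_partition lam \<longleftrightarrow> (\<forall>i. Poly_Mapping.lookup lam (Suc i) \<le> Poly_Mapping.lookup lam i)"

lift_definition transpose_part :: "composition \<Rightarrow> composition" is
  "\<lambda>(\<alpha> :: nat \<Rightarrow> nat) j. card {i. j < \<alpha> i}"
proof -
  fix \<alpha> :: "nat \<Rightarrow> nat"
  assume fin: "finite {i. \<alpha> i \<noteq> 0}"
  have "{j. card {i. j < \<alpha> i} \<noteq> 0} \<subseteq> (\<Union>i\<in>{i. \<alpha> i \<noteq> 0}. {..<\<alpha> i})"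
  proof
    fix j
    assume "j \<in> {j. card {i. j < \<alpha> i} \<noteq> 0}"
    then have "{i. j < \<alpha> i} \<noteq> {}"
      by (auto simp: card_eq_0_iff)
    then obtain i where "j < \<alpha> i"
      by blast
    then show "j \<in> (\<Union>i\<in>{i. \<alpha> i \<noteq> 0}. {..<\<alpha> i})"
      by (intro UN_I[of i]) auto
  qed
  then show "finite {j. card {i. j < \<alpha> i} \<noteq> 0}"
    by (rule finite_subset) (use fin in auto)
qed

definition shifted_entry :: "composition \<Rightarrow> nat \<Rightarrow> int" where
  "shifted_entry \<alpha> i = int (Poly_Mapping.lookup \<alpha> i) - 1 - int i"


section \<open>Power series in countably many indeterminates\<close>

text \<open>A monomial in the indeterminates \<open>X\<^sub>i\<close> is represented by its exponent vector,
  so that \<open>single i 1\<close> stands for \<open>X\<^sub>i\<close>, and addition for multiplication of monomials.\<close>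

type_synonym monomial = "nat \<Rightarrow>\<^sub>0 nat"

definition mono_degree :: "monomial \<Rightarrow> nat" where
  "mono_degree m = (\<Sum>i\<in>Poly_Mapping.keys m. Poly_Mapping.lookup m i)"

typedef power_series = "UNIV :: (monomial \<Rightarrow> int) set"
  morphisms coeff_ps Abs_power_series
  by simp

setup_lifting type_definition_power_series

definition splittings :: "monomial \<Rightarrow> (monomial \<times> monomial) set" where
  "splittings m = {(a, b). a + b = m}"

lemma finite_bounded_monomials:
  assumes "finite (A :: nat set)"
  shows "finite {m :: monomial. Poly_Mapping.keys m \<subseteq> A \<and> (\<forall>i. Poly_Mapping.lookup m i \<le> d)}" (is "finite ?S")
proof -
  let ?f = "\<lambda>m :: monomial. restrict (Poly_Mapping.lookup m) A"
  have "?f ` ?S \<subseteq> (\<Pi>\<^sub>E i\<in>A. {..d})"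
    by (auto simp: PiE_iff)
  then have "finite (?f ` ?S)"
    by (rule finite_subset) (auto intro: finite_PiE assms)
  moreover have "inj_on ?f ?S"
  proof (rule inj_onI, rule poly_mapping_eqI)
    fix m m' :: monomial and i
    assume m: "m \<in> ?S" and m': "m' \<in> ?S" and eq: "?f m = ?f m'"
    show "Poly_Mapping.lookup m i = Poly_Mapping.lookup m' i"
    proof (cases "i \<in> A")
      case True
      then show ?thesis using fun_cong[OF eq, of i] by simp
    next
      case False
      then have "i \<notin> Poly_Mapping.keys m" "i \<notin> Poly_Mapping.keys m'"
        using m m' by auto
      then show ?thesis by (simp add: in_keys_iff)
    qed
  qed
  ultimately show ?thesis
    by (rule finite_imageD)
qed

lemma lookup_le_mono_degree: "Poly_Mapping.lookup m i \<le> mono_degree m"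
  unfolding mono_degree_def
  by (cases "i \<in> Poly_Mapping.keys m") (auto intro: member_le_sum simp: in_keys_iff)

lemma mono_degree_add: "mono_degree (a + b) = mono_degree a + mono_degree b"
proof -
  let ?K = "Poly_Mapping.keys a \<union> Poly_Mapping.keys b"
  have ext: "mono_degree m = (\<Sum>i\<in>?K. Poly_Mapping.lookup m i)" if "Poly_Mapping.keys m \<subseteq> ?K" for m
    unfolding mono_degree_def using that
    by (intro sum.mono_neutral_left) (auto simp: in_keys_iff)
  have "mono_degree (a + b) = (\<Sum>i\<in>?K. Poly_Mapping.lookup (a + b) i)"
    by (rule ext) (rule keys_add)
  also have "\<dots> = (\<Sum>i\<in>?K. Poly_Mapping.lookup a i) + (\<Sum>i\<in>?K. Poly_Mapping.lookup b i)"
    by (simp add: lookup_add sum.distrib)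
  also have "\<dots> = mono_degree a + mono_degree b"
    by (simp add: ext)
  finally show ?thesis .
qed

lemma finite_splittings [simp]: "finite (splittings m)"
proof -
  let ?S = "{a. Poly_Mapping.keys a \<subseteq> Poly_Mapping.keys m \<and> (\<forall>i. Poly_Mapping.lookup a i \<le> mono_degree m)}"
  have *: "a \<in> ?S \<and> b \<in> ?S" if "a + b = m" for a b
  proof -
    have "Poly_Mapping.lookup a i + Poly_Mapping.lookup b i = Poly_Mapping.lookup m i" for i
      using that by (auto simp: lookup_add)
    moreover have "Poly_Mapping.lookup m i \<le> mono_degree m" for i
      by (rule lookup_le_mono_degree)
    ultimately have "Poly_Mapping.lookup a i \<le> Poly_Mapping.lookup m i \<and>
        Poly_Mapping.lookup b i \<le> Poly_Mapping.lookup m i \<and>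
        Poly_Mapping.lookup m i \<le> mono_degree m" for i
      by (metis le_add1 le_add2)
    then have bound: "Poly_Mapping.lookup a i \<le> Poly_Mapping.lookup m i"
        "Poly_Mapping.lookup b i \<le> Poly_Mapping.lookup m i"
        "Poly_Mapping.lookup m i \<le> mono_degree m" for i
      by auto
    have "Poly_Mapping.keys a \<subseteq> Poly_Mapping.keys m" "Poly_Mapping.keys b \<subseteq> Poly_Mapping.keys m"
      by (auto simp: in_keys_iff intro: less_le_trans[OF _ bound(1)] less_le_trans[OF _ bound(2)])
    then show ?thesis
      by (auto intro: le_trans[OF bound(1) bound(3)] le_trans[OF bound(2) bound(3)])
  qed
  have "splittings m \<subseteq> ?S \<times> ?S"
    unfolding splittings_def using * by fast
  then show ?thesis
    by (rule finite_subset) (simp add: finite_bounded_monomials)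
qed

instantiation power_series :: comm_ring_1
begin

lift_definition zero_power_series :: power_series is "\<lambda>_. 0" .
lift_definition one_power_series :: power_series is "\<lambda>m. if m = 0 then 1 else 0" .
lift_definition plus_power_series :: "power_series \<Rightarrow> power_series \<Rightarrow> power_series"
  is "\<lambda>f g m. f m + g m" .
lift_definition minus_power_series :: "power_series \<Rightarrow> power_series \<Rightarrow> power_series"
  is "\<lambda>f g m. f m - g m" .
lift_definition uminus_power_series :: "power_series \<Rightarrow> power_series"
  is "\<lambda>f m. - f m" .
lift_definition times_power_series :: "power_series \<Rightarrow> power_series \<Rightarrow> power_series"
  is "\<lambda>f g m. \<Sum>(a, b)\<in>splittings m. f a * g b" .

instance
proof
  fix f g h :: power_series
  show "f * g * h = f * (g * h)"
  proof transfer
    fix f g h :: "monomial \<Rightarrow> int"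
    show "(\<lambda>m. \<Sum>(a, b)\<in>splittings m. (\<Sum>(c, d)\<in>splittings a. f c * g d) * h b) =
          (\<lambda>m. \<Sum>(a, b)\<in>splittings m. f a * (\<Sum>(c, d)\<in>splittings b. g c * h d))"
    proof
      fix m
      have "(\<Sum>(a, b)\<in>splittings m. (\<Sum>(c, d)\<in>splittings a. f c * g d) * h b) =
            (\<Sum>x\<in>splittings m. \<Sum>y\<in>splittings (fst x). f (fst y) * g (snd y) * h (snd x))"
        by (simp add: sum_distrib_right case_prod_beta)
      also have "\<dots> = (\<Sum>(x, y)\<in>Sigma (splittings m) (\<lambda>x. splittings (fst x)).
                        f (fst y) * g (snd y) * h (snd x))"
        by (rule sum.Sigma) auto
      also have "\<dots> = (\<Sum>(x, y)\<in>Sigma (splittings m) (\<lambda>x. splittings (snd x)).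
                        f (fst x) * (g (fst y) * h (snd y)))"
        by (rule sum.reindex_bij_witness
              [of _ "\<lambda>(x, y). ((fst x + fst y, snd y), (fst x, fst y))"
                    "\<lambda>(x, y). ((fst y, snd y + snd x), (snd y, snd x))"])
           (auto simp: splittings_def algebra_simps)
      also have "\<dots> = (\<Sum>x\<in>splittings m. \<Sum>y\<in>splittings (snd x). f (fst x) * (g (fst y) * h (snd y)))"
        by (rule sum.Sigma[symmetric]) auto
      also have "\<dots> = (\<Sum>(a, b)\<in>splittings m. f a * (\<Sum>(c, d)\<in>splittings b. g c * h d))"
        by (simp add: sum_distrib_left case_prod_beta)
      finally show "(\<Sum>(a, b)\<in>splittings m. (\<Sum>(c, d)\<in>splittings a. f c * g d) * h b) =
        (\<Sum>(a, b)\<in>splittings m. f a * (\<Sum>(c, d)\<in>splittings b. g c * h d))" .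
    qed
  qed
  show "f * g = g * f"
    by transfer (rule ext, rule sum.reindex_bij_witness[of _ prod.swap prod.swap],
      auto simp: splittings_def ac_simps)
  show "1 * f = f"
  proof transfer
    fix f :: "monomial \<Rightarrow> int"
    show "(\<lambda>m. \<Sum>(a, b)\<in>splittings m. (if a = 0 then 1 else 0) * f b) = f"
    proof
      fix m
      have "(\<Sum>(a, b)\<in>splittings m. (if a = 0 then 1 else 0) * f b) =
            (\<Sum>(a, b)\<in>{(0 :: monomial, m)}. (if a = 0 then 1 else 0) * f b)"
        by (rule sum.mono_neutral_right) (simp, auto simp: splittings_def split: if_splits)
      then show "(\<Sum>(a, b)\<in>splittings m. (if a = 0 then 1 else 0) * f b) = f m"
        by simp
    qed
  qed
  show "(f + g) * h = f * h + g * h"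
    by transfer (auto simp: case_prod_beta distrib_right sum.distrib)
  show "f + g + h = f + (g + h)" by transfer (simp add: add.assoc)
  show "f + g = g + f" by transfer (simp add: add.commute)
  show "0 + f = f" by transfer simp
  show "- f + f = 0" by transfer simp
  show "f - g = f + - g" by transfer simp
  show "(0 :: power_series) \<noteq> 1" by transfer (metis zero_neq_one)
qed

end


section \<open>The ring of symmetric functions\<close>

text \<open>\<open>Poly_Mapping.map_key \<sigma> m\<close> has exponent \<open>m (\<sigma> i)\<close> at \<open>i\<close>.\<close>

definition symmetric_ps :: "power_series \<Rightarrow> bool" where
  "symmetric_ps f \<longleftrightarrow>
    (\<forall>\<sigma> m. bij \<sigma> \<longrightarrow> coeff_ps f (Poly_Mapping.map_key \<sigma> m) = coeff_ps f m)"

definition bounded_degree_ps :: "power_series \<Rightarrow> bool" where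
  "bounded_degree_ps f \<longleftrightarrow> (\<exists>d. \<forall>m. coeff_ps f m \<noteq> 0 \<longrightarrow> mono_degree m \<le> d)"

lemma lookup_map_key_bij:
  fixes \<sigma> :: "nat \<Rightarrow> nat" and m :: monomial
  assumes "bij \<sigma>"
  shows "Poly_Mapping.lookup (Poly_Mapping.map_key \<sigma> m) i = Poly_Mapping.lookup m (\<sigma> i)"
  by (subst map_key.rep_eq) (rule bij_is_inj[OF assms], simp)

lemma map_key_bij_inv:
  fixes \<sigma> :: "nat \<Rightarrow> nat" and m :: monomial
  assumes \<sigma>: "bij \<sigma>"
  shows "Poly_Mapping.map_key (inv_into UNIV \<sigma>) (Poly_Mapping.map_key \<sigma> m) = m"
    and "Poly_Mapping.map_key \<sigma> (Poly_Mapping.map_key (inv_into UNIV \<sigma>) m) = m"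
proof -
  have \<sigma>': "bij (inv_into UNIV \<sigma>)" using \<sigma> by (rule bij_imp_bij_inv)
  note [simp] = lookup_map_key_bij[OF \<sigma>] lookup_map_key_bij[OF \<sigma>']
    surj_f_inv_f[OF bij_is_surj[OF \<sigma>]] inv_f_f[OF bij_is_inj[OF \<sigma>]]
  show "Poly_Mapping.map_key (inv_into UNIV \<sigma>) (Poly_Mapping.map_key \<sigma> m) = m"
    by (rule poly_mapping_eqI) simp
  show "Poly_Mapping.map_key \<sigma> (Poly_Mapping.map_key (inv_into UNIV \<sigma>) m) = m"
    by (rule poly_mapping_eqI) simp
qed

lemma map_key_bij_add:
  fixes \<sigma> :: "nat \<Rightarrow> nat" and a b :: monomial
  assumes \<sigma>: "bij \<sigma>"
  shows "Poly_Mapping.map_key \<sigma> (a + b) =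
     Poly_Mapping.map_key \<sigma> a + Poly_Mapping.map_key \<sigma> b"
  by (rule poly_mapping_eqI) (simp only: lookup_map_key_bij[OF \<sigma>] lookup_add)

lemma map_key_bij_eq_iff:
  fixes \<sigma> :: "nat \<Rightarrow> nat" and a b :: monomial
  assumes \<sigma>: "bij \<sigma>"
  shows "Poly_Mapping.map_key \<sigma> a = Poly_Mapping.map_key \<sigma> b \<longleftrightarrow> a = b"
proof
  assume "Poly_Mapping.map_key \<sigma> a = Poly_Mapping.map_key \<sigma> b"
  from arg_cong[OF this, of "Poly_Mapping.map_key (inv_into UNIV \<sigma>)"] show "a = b"
    by (simp only: map_key_bij_inv(1)[OF \<sigma>])
qed simp

lemma symmetric_ps_mult:
  assumes "symmetric_ps f" "symmetric_ps g"
  shows "symmetric_ps (f * g)"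
  unfolding symmetric_ps_def
proof (intro allI impI)
  fix \<sigma> :: "nat \<Rightarrow> nat" and m
  assume \<sigma>: "bij \<sigma>"
  let ?k = "Poly_Mapping.map_key \<sigma>" and ?k' = "Poly_Mapping.map_key (inv_into UNIV \<sigma>)"
  have sym: "coeff_ps f (?k a) = coeff_ps f a" "coeff_ps g (?k a) = coeff_ps g a" for a :: monomial
    using assms \<sigma> by (simp_all only: symmetric_ps_def)
  have k: "?k (a + b) = ?k a + ?k b" for a b :: monomial
    by (rule map_key_bij_add[OF \<sigma>])
  have k': "?k' (a + b) = ?k' a + ?k' b" for a b :: monomial
    by (rule map_key_bij_add[OF bij_imp_bij_inv[OF \<sigma>]])
  have kk': "?k' (?k a) = a" "?k (?k' a) = a" for a :: monomial
    by (rule map_key_bij_inv[OF \<sigma>])+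
  have split1: "map_prod ?k ?k x \<in> splittings (?k m)" if "x \<in> splittings m" for x
    using that k[of "fst x" "snd x"] by (cases x) (simp add: splittings_def)
  have split2: "map_prod ?k' ?k' x \<in> splittings m" if "x \<in> splittings (?k m)" for x
    using that k'[of "fst x" "snd x"] by (cases x) (simp add: splittings_def kk')
  have "(\<Sum>(a, b)\<in>splittings m. coeff_ps f a * coeff_ps g b) =
        (\<Sum>(a, b)\<in>splittings (?k m). coeff_ps f a * coeff_ps g b)"
  proof (rule sum.reindex_bij_witness[of _ "map_prod ?k' ?k'" "map_prod ?k ?k"])
    fix x :: "monomial \<times> monomial"
    show "map_prod ?k' ?k' (map_prod ?k ?k x) = x" "map_prod ?k ?k (map_prod ?k' ?k' x) = x"
      by (cases x, simp add: kk')+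
    show "(case map_prod ?k ?k x of (a, b) \<Rightarrow> coeff_ps f a * coeff_ps g b) =
        (case x of (a, b) \<Rightarrow> coeff_ps f a * coeff_ps g b)"
      by (cases x) (simp add: sym)
  qed (simp_all only: split1 split2)
  then show "coeff_ps (f * g) (?k m) = coeff_ps (f * g) m"
    by (simp only: times_power_series.rep_eq)
qed

lemma bounded_degree_ps_mult:
  assumes "bounded_degree_ps f" "bounded_degree_ps g"
  shows "bounded_degree_ps (f * g)"
proof -
  obtain c d where c: "\<And>m. coeff_ps f m \<noteq> 0 \<Longrightarrow> mono_degree m \<le> c"
    and d: "\<And>m. coeff_ps g m \<noteq> 0 \<Longrightarrow> mono_degree m \<le> d"
    using assms by (auto simp: bounded_degree_ps_def)
  have "mono_degree m \<le> c + d" if nz: "coeff_ps (f * g) m \<noteq> 0" for m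
  proof -
    obtain x where x: "x \<in> splittings m" "coeff_ps f (fst x) * coeff_ps g (snd x) \<noteq> 0"
      using nz unfolding times_power_series.rep_eq case_prod_beta by (meson sum.neutral)
    then have "mono_degree (fst x) \<le> c" "mono_degree (snd x) \<le> d"
      by (auto intro: c d)
    moreover have "m = fst x + snd x"
      using x(1) by (auto simp: splittings_def)
    ultimately show ?thesis
      by (simp add: mono_degree_add)
  qed
  then show ?thesis
    by (auto simp: bounded_degree_ps_def)
qed

lemma bounded_degree_ps_add:
  assumes "bounded_degree_ps f" "bounded_degree_ps g"
  shows "bounded_degree_ps (f + g)"
proof -
  obtain c d where c: "\<And>m. coeff_ps f m \<noteq> 0 \<Longrightarrow> mono_degree m \<le> c"
    and d: "\<And>m. coeff_ps g m \<noteq> 0 \<Longrightarrow> mono_degree m \<le> d"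
    using assms by (auto simp: bounded_degree_ps_def)
  have "mono_degree m \<le> max c d" if nz: "coeff_ps (f + g) m \<noteq> 0" for m
  proof -
    have "coeff_ps f m \<noteq> 0 \<or> coeff_ps g m \<noteq> 0"
      using nz by (auto simp: plus_power_series.rep_eq)
    then show ?thesis
      using c[of m] d[of m] by auto
  qed
  then show ?thesis
    by (auto simp: bounded_degree_ps_def)
qed

lemma map_key_bij_eq_0_iff:
  fixes \<sigma> :: "nat \<Rightarrow> nat" and m :: monomial
  assumes \<sigma>: "bij \<sigma>"
  shows "Poly_Mapping.map_key \<sigma> m = 0 \<longleftrightarrow> m = 0"
  using map_key_bij_eq_iff[OF \<sigma>, of m 0] by (simp only: map_key_zero[OF bij_is_inj[OF \<sigma>]])

typedef symfun = "{f. symmetric_ps f \<and> bounded_degree_ps f}"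
  morphisms ps_of_symfun Abs_symfun
proof (rule exI[of _ 0])
  show "0 \<in> {f. symmetric_ps f \<and> bounded_degree_ps f}"
    by (simp add: symmetric_ps_def bounded_degree_ps_def zero_power_series.rep_eq)
qed

setup_lifting type_definition_symfun

instantiation symfun :: comm_ring_1
begin

lift_definition zero_symfun :: symfun is 0
  by (auto simp: symmetric_ps_def bounded_degree_ps_def zero_power_series.rep_eq)
lift_definition one_symfun :: symfun is 1
  by (auto simp: symmetric_ps_def bounded_degree_ps_def one_power_series.rep_eq
        map_key_bij_eq_0_iff)
lift_definition plus_symfun :: "symfun \<Rightarrow> symfun \<Rightarrow> symfun" is "(+)"
  by (simp add: bounded_degree_ps_add) (auto simp: symmetric_ps_def plus_power_series.rep_eq)
lift_definition uminus_symfun :: "symfun \<Rightarrow> symfun" is uminus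
  by (auto simp: symmetric_ps_def bounded_degree_ps_def uminus_power_series.rep_eq)
lift_definition times_symfun :: "symfun \<Rightarrow> symfun \<Rightarrow> symfun" is "(*)"
  by (simp add: bounded_degree_ps_mult symmetric_ps_mult)
definition minus_symfun :: "symfun \<Rightarrow> symfun \<Rightarrow> symfun" where
  "minus_symfun f g = f + - g"

instance
proof
  fix f g h :: symfun
  show "f * g * h = f * (g * h)" by transfer (rule mult.assoc)
  show "f * g = g * f" by transfer (rule mult.commute)
  show "1 * f = f" by transfer (rule mult_1_left)
  show "(f + g) * h = f * h + g * h" by transfer (rule distrib_right)
  show "f + g + h = f + (g + h)" by transfer (rule add.assoc)
  show "f + g = g + f" by transfer (rule add.commute)
  show "0 + f = f" by transfer (rule add_0_left)
  show "- f + f = 0" by transfer (rule left_minus)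
  show "f - g = f + - g" by (rule minus_symfun_def)
  show "(0 :: symfun) \<noteq> 1" by transfer (rule zero_neq_one)
qed

end

text \<open>The coefficient of \<open>m\<close> in \<open>e\<^sub>d\<close> counts the index sets \<open>S = {i\<^sub>1 < \<dots> < i\<^sub>d}\<close>
  whose product of indeterminates is \<open>m\<close> (there is at most one).\<close>

definition index_sets :: "nat \<Rightarrow> monomial \<Rightarrow> nat set set" where
  "index_sets d m = {S. finite S \<and> card S = d \<and> (\<Sum>i\<in>S. Poly_Mapping.single i 1) = m}"

lift_definition elementary_ps :: "nat \<Rightarrow> power_series" is
  "\<lambda>d m. int (card (index_sets d m))" .

lemma lookup_sum_single:
  assumes "finite S"
  shows "Poly_Mapping.lookup (\<Sum>i\<in>S. Poly_Mapping.single i (1 :: nat)) j = (if j \<in> S then 1 else 0)"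
  using assms by (simp add: lookup_sum lookup_single when_def)

lemma index_sets_iff:
  "S \<in> index_sets d m \<longleftrightarrow>
    finite S \<and> card S = d \<and> (\<forall>j. Poly_Mapping.lookup m j = (if j \<in> S then 1 else 0))"
proof (cases "finite S")
  case True
  then show ?thesis
    by (auto simp: index_sets_def poly_mapping_eq_iff fun_eq_iff
        lookup_sum_single[unfolded One_nat_def])
next
  case False
  then show ?thesis
    by (simp add: index_sets_def)
qed

lift_definition elementary_nat :: "nat \<Rightarrow> symfun" is elementary_ps
proof
  fix d
  have "card (index_sets d (Poly_Mapping.map_key \<sigma> m)) = card (index_sets d m)"
    if \<sigma>: "bij \<sigma>" for \<sigma> m
  proof -
    have inj: "inj \<sigma>" and surj: "surj \<sigma>"
      using \<sigma> by (auto simp: bij_is_inj bij_is_surj)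
    have "bij_betw ((`) \<sigma>) (index_sets d (Poly_Mapping.map_key \<sigma> m)) (index_sets d m)"
    proof (rule bij_betw_byWitness[where f' = "(`) (inv_into UNIV \<sigma>)"])
      show "\<forall>S\<in>index_sets d (Poly_Mapping.map_key \<sigma> m). inv_into UNIV \<sigma> ` \<sigma> ` S = S"
        using inj by (simp add: image_image)
      show "\<forall>S\<in>index_sets d m. \<sigma> ` inv_into UNIV \<sigma> ` S = S"
        using surj by (simp add: image_image surj_f_inv_f)
      show "(`) \<sigma> ` index_sets d (Poly_Mapping.map_key \<sigma> m) \<subseteq> index_sets d m"
      proof clarify
        fix S
        assume S: "S \<in> index_sets d (Poly_Mapping.map_key \<sigma> m)"
        have "Poly_Mapping.lookup m j = (if j \<in> \<sigma> ` S then 1 else 0)" for j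
        proof -
          obtain i where i: "j = \<sigma> i" using surj by blast
          have "Poly_Mapping.lookup m (\<sigma> i) = (if i \<in> S then 1 else 0)"
            using S \<sigma> by (simp add: index_sets_iff lookup_map_key_bij)
          then show ?thesis
            using i inj by (simp add: inj_image_mem_iff)
        qed
        then show "\<sigma> ` S \<in> index_sets d m"
          using S inj by (auto simp: index_sets_iff card_image inj_on_subset)
      qed
      show "(`) (inv_into UNIV \<sigma>) ` index_sets d m \<subseteq> index_sets d (Poly_Mapping.map_key \<sigma> m)"
      proof clarify
        fix S
        assume S: "S \<in> index_sets d m"
        have "inj_on (inv_into UNIV \<sigma>) S"
          using \<sigma> by (meson bij_imp_bij_inv bij_is_inj inj_on_subset subset_UNIV)
        moreover have "i \<in> inv_into UNIV \<sigma> ` S \<longleftrightarrow> \<sigma> i \<in> S" for i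
          using bij_vimage_eq_inv_image[OF \<sigma>, of S] by auto
        ultimately show "inv_into UNIV \<sigma> ` S \<in> index_sets d (Poly_Mapping.map_key \<sigma> m)"
          using S \<sigma> by (simp add: index_sets_iff card_image lookup_map_key_bij)
      qed
    qed
    then show ?thesis by (rule bij_betw_same_card)
  qed
  then show "symmetric_ps (elementary_ps d)"
    by (simp add: symmetric_ps_def elementary_ps.rep_eq)
  have "mono_degree m \<le> d" if nz: "coeff_ps (elementary_ps d) m \<noteq> 0" for m
  proof -
    have "index_sets d m \<noteq> {}"
      using nz by (auto simp: elementary_ps.rep_eq)
    then obtain S where "S \<in> index_sets d m"
      by blast
    then have S: "finite S" "card S = d" "\<And>j. Poly_Mapping.lookup m j = (if j \<in> S then 1 else 0)"
      by (auto simp: index_sets_iff)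
    have "Poly_Mapping.keys m = S"
      by (auto simp: in_keys_iff S(3) split: if_splits)
    then show ?thesis
      using S by (simp add: mono_degree_def)
  qed
  then show "bounded_degree_ps (elementary_ps d)"
    by (auto simp: bounded_degree_ps_def)
qed

definition elementary :: "int \<Rightarrow> symfun" where
  "elementary d = (if d < 0 then 0 else elementary_nat (nat d))"


section \<open>Schur functions\<close>

type_synonym mpoly_int = "monomial \<Rightarrow>\<^sub>0 int"

definition poly_X :: "nat \<Rightarrow> mpoly_int" where
  "poly_X i = Poly_Mapping.single (Poly_Mapping.single i 1) 1"

text \<open>Setting \<open>X\<^sub>i = 0\<close> for all \<open>i \<ge> n\<close>; the result is a polynomial in \<open>X\<^sub>0, \<dots>, X\<^sub>n\<^sub>-\<^sub>1\<close>
  because the degree is bounded.\<close>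

lift_definition specialise :: "nat \<Rightarrow> symfun \<Rightarrow> mpoly_int" is
  "\<lambda>n f m. if Poly_Mapping.keys m \<subseteq> {..<n} then coeff_ps f m else 0"
proof -
  fix n :: nat and f
  assume "symmetric_ps f \<and> bounded_degree_ps f"
  then obtain d where d: "\<And>m. coeff_ps f m \<noteq> 0 \<Longrightarrow> mono_degree m \<le> d"
    by (auto simp: bounded_degree_ps_def)
  have "{m. (if Poly_Mapping.keys m \<subseteq> {..<n} then coeff_ps f m else 0) \<noteq> 0} \<subseteq>
        {m. Poly_Mapping.keys m \<subseteq> {..<n} \<and> (\<forall>i. Poly_Mapping.lookup m i \<le> d)}"
    using d lookup_le_mono_degree by (auto split: if_splits intro: order_trans)
  then show "finite {m. (if Poly_Mapping.keys m \<subseteq> {..<n} then coeff_ps f m else 0) \<noteq> 0}"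
    by (rule finite_subset) (simp add: finite_bounded_monomials)
qed

definition alternant :: "nat \<Rightarrow> composition \<Rightarrow> mpoly_int" where
  "alternant n \<alpha> =
    (\<Sum>\<sigma> | \<sigma> permutes {..<n}. of_int (sign \<sigma>) * (\<Prod>i<n. poly_X (\<sigma> i) ^ Poly_Mapping.lookup \<alpha> i))"

lift_definition staircase :: "nat \<Rightarrow> composition" is
  "\<lambda>n i. if i < n then n - 1 - i else 0"
  by (rule finite_subset[of _ "{..<_}"]) (auto split: if_splits)

text \<open>The quotient of alternants is taken in the integral domain of polynomials, where it is
  unique because \<open>alternant n (staircase n)\<close> (the Vandermonde determinant) is nonzero.\<close>

definition schur_poly :: "nat \<Rightarrow> composition \<Rightarrow> mpoly_int" where
  "schur_poly n \<alpha> =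
    (if in_vec n \<alpha>
     then (THE q. q * alternant n (staircase n) = alternant n (staircase n + \<alpha>))
     else 0)"

definition schur :: "composition \<Rightarrow> symfun" where
  "schur \<alpha> = (THE s. \<forall>n. specialise n s = schur_poly n \<alpha>)"


section \<open>Scalar product and skew Schur functions\<close>

text \<open>Additivity in one argument together with symmetry yields bilinearity over the integers.\<close>

definition symmetric_bilinear :: "(symfun \<Rightarrow> symfun \<Rightarrow> int) \<Rightarrow> bool" where
  "symmetric_bilinear B \<longleftrightarrow>
    (\<forall>f g. B f g = B g f) \<and> (\<forall>f g h. B (f + g) h = B f h + B g h)"

definition scalar_product :: "symfun \<Rightarrow> symfun \<Rightarrow> int" where
  "scalar_product = (THE B. symmetric_bilinear B \<and>
    (\<forall>lam mu. is_partition lam \<longrightarrow> is_partition mu \<longrightarrow>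
      B (schur lam) (schur mu) = (if lam = mu then 1 else 0)))"

definition skew_schur :: "composition \<Rightarrow> composition \<Rightarrow> symfun" where
  "skew_schur lam mu =
    (THE s. \<forall>f. scalar_product s f = scalar_product (schur lam) (schur mu * f))"

end

theory Submission
  imports Defs
begin

text \<open>
  Write \<open>D\<close> for the determinant. Setting the last of \<open>n + 1\<close> variables apart turns every row of \<open>D\<close>
  into a sum of two rows, because \<open>e\<^sub>d(x, t) = e\<^sub>d(x) + t e\<^sub>d\<^sub>-\<^sub>1(x)\<close>. Expanding, every term with
  two equal rows or a zero row vanishes, and the remaining ones are indexed by the partitions
  \<open>\<kappa>\<close> for which \<open>\<lambda>/\<kappa>\<close> is a horizontal strip. For \<open>\<mu> = 0\<close> the alternants satisfy the same
  branching rule, so \<open>D = s\<^sub>\<lambda>\<close> in that case. The product with a complete symmetric function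
  \<open>h\<^sub>k\<close> obeys the adjoint rule (Pieri), so induction on the number of variables shows that the
  coefficient of \<open>x\<^sup>m\<close> in \<open>D\<close> is \<open>\<langle>s\<^sub>\<lambda>, s\<^sub>\<mu> h\<^sub>m\<rangle>\<close>. For \<open>\<mu> = 0\<close> this says that pairing any symmetric
  function with \<open>h\<^sub>m\<close> extracts its coefficient at \<open>x\<^sup>m\<close>, whence \<open>D\<close> represents the functional
  \<open>f \<mapsto> \<langle>s\<^sub>\<lambda>, s\<^sub>\<mu> f\<rangle>\<close>.
\<close>

section \<open>Coefficients, specialisation and alternants\<close>

text \<open>Schur functions, the scalar product and skew Schur functions are given by definite
  descriptions, so each needs existence as well as uniqueness. For \<mu> = 0 the determinant itself
  supplies the required symmetric function; no quotient of alternants is computed, only products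
  with a_\<delta>. Coordinates are read off in the same way: the coefficient of s_\<alpha> in f is
  that of a_\<delta> f at the exponent \<delta> + \<alpha>.

  The induction closes because both sides obey one recursion in the outer shape \<alpha> while \<mu>
  stays fixed. Adding a variable to the determinant removes a horizontal strip from \<alpha>, and so
  does reading the coordinate at \<alpha> of a product with h_k. With no variables left, both sides
  are the Kronecker delta of \<alpha> and \<mu>. Transposes make the rows fit: a horizontal strip
  shortens each column by at most one, which is exactly the choice between the two terms of e_d(x,
  t).\<close>

abbreviation lookup :: "('a \<Rightarrow>\<^sub>0 'b::zero) \<Rightarrow> 'a \<Rightarrow> 'b" where
  "lookup \<equiv> Poly_Mapping.lookup"

abbreviation keys :: "('a \<Rightarrow>\<^sub>0 'b::zero) \<Rightarrow> 'a set" where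
  "keys \<equiv> Poly_Mapping.keys"

abbreviation single :: "'a \<Rightarrow> 'b::zero \<Rightarrow> 'a \<Rightarrow>\<^sub>0 'b" where
  "single \<equiv> Poly_Mapping.single"

abbreviation map_key :: "('b \<Rightarrow> 'a) \<Rightarrow> ('a \<Rightarrow>\<^sub>0 'c::zero) \<Rightarrow> 'b \<Rightarrow>\<^sub>0 'c" where
  "map_key \<equiv> Poly_Mapping.map_key"

abbreviation coef :: "symfun \<Rightarrow> monomial \<Rightarrow> int" where
  "coef f \<equiv> coeff_ps (ps_of_symfun f)"

section \<open>Coefficients of products and specialisations\<close>

lemma lookup_times:
  fixes f g :: mpoly_int
  shows "lookup (f * g) m = (\<Sum>(a, b)\<in>splittings m. lookup f a * lookup g b)"
proof -
  let ?F = "\<lambda>l. lookup f l * (\<Sum>q. lookup g q when m = l + q)"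
  have F: "?F (fst x) = lookup f (fst x) * lookup g (snd x)" if "x \<in> splittings m" for x
  proof -
    have "m = fst x + q \<longleftrightarrow> q = snd x" for q
      using that by (auto simp: splittings_def)
    then show ?thesis by simp
  qed
  have "lookup (f * g) m = (\<Sum>l. ?F l)"
    by (simp add: lookup_mult)
  also have "\<dots> = (\<Sum>l\<in>fst ` splittings m. ?F l)"
  proof (rule Sum_any.expand_superset)
    show "{l. ?F l \<noteq> 0} \<subseteq> fst ` splittings m"
    proof
      fix l assume "l \<in> {l. ?F l \<noteq> 0}"
      then have "(\<Sum>q. lookup g q when m = l + q) \<noteq> 0" by auto
      then obtain q where "(lookup g q when m = l + q) \<noteq> 0"
        by (rule Sum_any.not_neutral_obtains_not_neutral)
      then have "(l, q) \<in> splittings m" by (simp add: splittings_def)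
      then show "l \<in> fst ` splittings m" by force
    qed
  qed simp
  also have "\<dots> = (\<Sum>x\<in>splittings m. ?F (fst x))"
    by (subst sum.reindex) (auto simp: inj_on_def splittings_def)
  also have "\<dots> = (\<Sum>x\<in>splittings m. lookup f (fst x) * lookup g (snd x))"
    by (rule sum.cong[OF refl F])
  finally show ?thesis by (simp add: case_prod_beta)
qed

lemma lookup_monom_times:
  fixes q :: mpoly_int
  shows "lookup (single a 1 * q) (a + y) = lookup q y"
proof -
  have "lookup (single a 1 * q) (a + y) =
      (\<Sum>x\<in>splittings (a + y). if x = (a, y) then lookup q y else 0)"
    unfolding lookup_times
  proof (rule sum.cong[OF refl])
    fix x assume x: "x \<in> splittings (a + y)"
    then have "fst x = a \<longleftrightarrow> x = (a, y)"
      by (cases x) (auto simp: splittings_def)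
    then show "(case x of (b, c) \<Rightarrow> lookup (single a (1 :: int)) b * lookup q c) =
        (if x = (a, y) then lookup q y else 0)"
      by (auto simp: case_prod_beta lookup_single when_def)
  qed
  also have "\<dots> = (\<Sum>x\<in>{(a, y)}. if x = (a, y) then lookup q y else 0)"
    by (rule sum.mono_neutral_right) (simp, auto simp: splittings_def)
  also have "\<dots> = lookup q y"
    by simp
  finally show ?thesis .
qed

lemma lookup_monom_times_eq_0:
  fixes q :: mpoly_int
  assumes "\<And>y. x \<noteq> a + y"
  shows "lookup (single a 1 * q) x = 0"
  unfolding lookup_times
  by (rule sum.neutral) (use assms in \<open>auto simp: splittings_def lookup_single when_def\<close>)

lemma monomial_le_iff:
  fixes a x :: monomial
  shows "(\<exists>y. x = a + y) \<longleftrightarrow> (\<forall>i. lookup a i \<le> lookup x i)"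
proof
  assume "\<forall>i. lookup a i \<le> lookup x i"
  then have "x = a + (x - a)"
    by (intro poly_mapping_eqI) (simp add: lookup_add lookup_minus)
  then show "\<exists>y. x = a + y" by blast
qed (auto simp: lookup_add)

lemma keys_add_nat: "keys (a + b :: monomial) = keys a \<union> keys b"
  by (auto simp: in_keys_iff lookup_add)

lemma lookup_specialise:
  "lookup (specialise n f) m = (if keys m \<subseteq> {..<n} then coef f m else 0)"
  by (simp add: specialise.rep_eq)

lemma coef_mult: "coef (f * g) m = (\<Sum>(a, b)\<in>splittings m. coef f a * coef g b)"
  by (simp add: times_symfun.rep_eq times_power_series.rep_eq)

lemma coef_add: "coef (f + g) m = coef f m + coef g m"
  by (simp add: plus_symfun.rep_eq plus_power_series.rep_eq)

lemma coef_0: "coef 0 m = 0"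
  by (simp add: zero_symfun.rep_eq zero_power_series.rep_eq)

lemma coef_1: "coef 1 m = (if m = 0 then 1 else 0)"
  by (simp add: one_symfun.rep_eq one_power_series.rep_eq)

lemma coef_uminus: "coef (- f) m = - coef f m"
  by (simp add: uminus_symfun.rep_eq uminus_power_series.rep_eq)

lemma coef_diff: "coef (f - g) m = coef f m - coef g m"
  unfolding minus_symfun_def coef_add coef_uminus by simp

lemma coef_sum: "coef (sum f A) m = (\<Sum>x\<in>A. coef (f x) m)"
  by (induction A rule: infinite_finite_induct) (simp_all add: coef_0 coef_add)

lemma symfun_eqI: "(\<And>m. coef f m = coef g m) \<Longrightarrow> f = g"
  by (metis coeff_ps_inject ext ps_of_symfun_inject)

lemma coef_of_nat_mult: "coef (of_nat z * f) m = int z * coef f m"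
  by (induction z) (simp_all add: coef_0 coef_add algebra_simps)

lemma coef_of_int_mult: "coef (of_int z * f) m = z * coef f m"
  by (cases z rule: int_cases2) (simp_all add: coef_of_nat_mult coef_uminus)

lemma coef_map_key: "bij \<sigma> \<Longrightarrow> coef f (map_key \<sigma> m) = coef f m"
  using ps_of_symfun[of f] by (simp add: symmetric_ps_def)

lemma specialise_mult: "specialise n (f * g) = specialise n f * specialise n g"
proof (rule poly_mapping_eqI)
  fix m
  show "lookup (specialise n (f * g)) m = lookup (specialise n f * specialise n g) m"
  proof (cases "keys m \<subseteq> {..<n}")
    case True
    then have "keys a \<subseteq> {..<n} \<and> keys b \<subseteq> {..<n}" if "(a, b) \<in> splittings m" for a b
      using that by (auto simp: splittings_def keys_add_nat)
    with True show ?thesis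
      unfolding lookup_times lookup_specialise coef_mult
      by (auto intro!: sum.cong)
  next
    case False
    then have "\<not> (keys a \<subseteq> {..<n} \<and> keys b \<subseteq> {..<n})" if "(a, b) \<in> splittings m" for a b
      using that by (auto simp: splittings_def keys_add_nat)
    then have "lookup (specialise n f * specialise n g) m = 0"
      unfolding lookup_times lookup_specialise by (intro sum.neutral) auto
    with False show ?thesis
      by (simp add: lookup_specialise)
  qed
qed

lemma specialise_add: "specialise n (f + g) = specialise n f + specialise n g"
  by (rule poly_mapping_eqI) (simp add: lookup_specialise lookup_add coef_add)

lemma specialise_1: "specialise n 1 = 1"
  by (rule poly_mapping_eqI) (simp add: lookup_specialise coef_1 lookup_one when_def)

lemma specialise_0: "specialise n 0 = 0"
  by (rule poly_mapping_eqI) (simp add: lookup_specialise coef_0)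

interpretation specialise: comm_ring_hom "specialise n"
  by unfold_locales (simp_all add: specialise_0 specialise_1 specialise_add specialise_mult)

text \<open>Every monomial involves finitely many variables, so the specialisations jointly lose
  nothing; this is the uniqueness behind the definite description of \<open>schur\<close>.\<close>

lemma specialise_inject:
  assumes "\<And>n. specialise n f = specialise n g"
  shows "f = g"
proof (rule symfun_eqI)
  fix m :: monomial
  obtain n where "keys m \<subseteq> {..<n}"
    using finite_nat_iff_bounded[of "keys m"] by auto
  then show "coef f m = coef g m"
    using assms[of n] lookup_specialise[of n f m] lookup_specialise[of n g m] by simp
qed

section \<open>Permutations of variables, alternants and antisymmetry\<close>

lemma lookup_map_key_perm:
  "\<sigma> permutes {..<n} \<Longrightarrow> lookup (map_key \<sigma> m) i = lookup (m :: monomial) (\<sigma> i)"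
  by (rule lookup_map_key_bij[OF permutes_bij])

lemma map_key_perm_compose:
  assumes "\<sigma> permutes {..<n}" "\<tau> permutes {..<n}"
  shows "map_key \<sigma> (map_key \<tau> m) = map_key (\<tau> \<circ> \<sigma>) (m :: monomial)"
  by (rule poly_mapping_eqI)
    (simp add: lookup_map_key_perm[OF assms(1)] lookup_map_key_perm[OF assms(2)]
      lookup_map_key_perm[OF permutes_compose[OF assms]])

lemma poly_X_power: "poly_X i ^ k = single (single i k) 1"
  by (induction k) (simp_all add: poly_X_def mult_single flip: single_add single_one)

lemma prod_single:
  fixes a :: "'i \<Rightarrow> monomial"
  shows "(\<Prod>i\<in>A. single (a i) (1 :: int)) = single (\<Sum>i\<in>A. a i) 1"
  by (induction A rule: infinite_finite_induct) (simp_all add: mult_single flip: single_one)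

text \<open>Moves the permutation from the term of an alternant to the exponent being looked up, so
  that a coefficient becomes a signed count of the \<sigma> that carry \<open>y\<close> to
  \<alpha>.\<close>

lemma permuted_monomial_eq_iff:
  assumes \<sigma>: "\<sigma> permutes {..<n}" and \<alpha>: "in_vec n \<alpha>"
  shows "(\<Sum>i<n. single (\<sigma> i) (lookup \<alpha> i)) = y \<longleftrightarrow> map_key \<sigma> y = \<alpha>"
proof -
  have L: "lookup (\<Sum>i<n. single (\<sigma> i) (lookup \<alpha> i)) (\<sigma> j) = lookup \<alpha> j" for j
  proof -
    have "lookup (\<Sum>i<n. single (\<sigma> i) (lookup \<alpha> i)) (\<sigma> j) = (\<Sum>i<n. if i = j then lookup \<alpha> i else 0)"
      unfolding lookup_sum
      by (rule sum.cong) (auto simp: lookup_single when_def inj_eq[OF permutes_inj[OF \<sigma>]])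
    also have "\<dots> = lookup \<alpha> j"
      using \<alpha> by (auto simp: in_vec_def in_keys_iff subset_iff)
    finally show ?thesis .
  qed
  show ?thesis
  proof
    assume "(\<Sum>i<n. single (\<sigma> i) (lookup \<alpha> i)) = y"
    then show "map_key \<sigma> y = \<alpha>"
      using L by (intro poly_mapping_eqI) (auto simp: lookup_map_key_perm[OF \<sigma>])
  next
    assume *: "map_key \<sigma> y = \<alpha>"
    show "(\<Sum>i<n. single (\<sigma> i) (lookup \<alpha> i)) = y"
    proof (rule poly_mapping_eqI)
      fix i
      obtain j where i: "i = \<sigma> j"
        using permutes_surj[OF \<sigma>] by (metis surjD)
      show "lookup (\<Sum>i<n. single (\<sigma> i) (lookup \<alpha> i)) i = lookup y i"
        unfolding i L using * by (auto simp: lookup_map_key_perm[OF \<sigma>])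
    qed
  qed
qed

lemma alternant_eq_sum_monoms:
  "alternant n \<alpha> = (\<Sum>\<sigma> | \<sigma> permutes {..<n}.
     of_int (sign \<sigma>) * single (\<Sum>i<n. single (\<sigma> i) (lookup \<alpha> i)) 1)"
  unfolding alternant_def poly_X_power prod_single ..

lemma lookup_of_int_mult: "lookup (of_int z * p :: mpoly_int) m = z * lookup p m"
proof -
  have "lookup (of_nat k * p :: mpoly_int) m = int k * lookup p m" for k
    by (induction k) (simp_all add: lookup_add algebra_simps)
  then show ?thesis
    by (cases z rule: int_cases2) simp_all
qed

lemma lookup_alternant:
  assumes \<alpha>: "in_vec n \<alpha>"
  shows "lookup (alternant n \<alpha>) y =
    (\<Sum>\<sigma> | \<sigma> permutes {..<n}. if map_key \<sigma> y = \<alpha> then sign \<sigma> else 0)"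
  unfolding alternant_eq_sum_monoms lookup_sum lookup_of_int_mult
proof (rule sum.cong[OF refl])
  fix \<sigma> assume "\<sigma> \<in> {\<sigma>. \<sigma> permutes {..<n}}"
  then show "sign \<sigma> * lookup (single (\<Sum>i<n. single (\<sigma> i) (lookup \<alpha> i)) 1) y =
      (if map_key \<sigma> y = \<alpha> then sign \<sigma> else 0)"
    using permuted_monomial_eq_iff[of \<sigma> n \<alpha> y] \<alpha> by (auto simp: lookup_single when_def)
qed

definition alternating :: "nat \<Rightarrow> mpoly_int \<Rightarrow> bool" where
  "alternating n g \<longleftrightarrow>
    (\<forall>\<sigma> m. \<sigma> permutes {..<n} \<longrightarrow> lookup g (map_key \<sigma> m) = sign \<sigma> * lookup g m) \<and>
    (\<forall>m. \<not> keys m \<subseteq> {..<n} \<longrightarrow> lookup g m = 0)"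

lemma keys_map_key_perm:
  assumes "\<sigma> permutes {..<n}"
  shows "keys (map_key \<sigma> (m :: monomial)) \<subseteq> {..<n} \<longleftrightarrow> keys m \<subseteq> {..<n}"
proof -
  have "\<sigma> i < n \<longleftrightarrow> i < n" for i
    using permutes_in_image[OF assms, of i] by simp
  moreover have "\<exists>j. i = \<sigma> j" for i
    using permutes_surj[OF assms] by (metis surjD)
  ultimately show ?thesis
    unfolding subset_iff keys_map_key[OF permutes_inj[OF assms]] vimage_eq lessThan_iff
    by metis
qed

lemma alternating_alternant:
  assumes \<alpha>: "in_vec n \<alpha>"
  shows "alternating n (alternant n \<alpha>)"
  unfolding alternating_def
proof (intro conjI allI impI)
  fix \<tau> and m :: monomial
  assume \<tau>: "\<tau> permutes {..<n}"
  have "lookup (alternant n \<alpha>) m = (\<Sum>\<sigma> | \<sigma> permutes {..<n}. if map_key (\<tau> \<circ> \<sigma>) m = \<alpha> then sign (\<tau> \<circ> \<sigma>) else 0)"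
    unfolding lookup_alternant[OF \<alpha>]
    by (rule setum_permutations_compose_left[OF \<tau>])
  also have "\<dots> = (\<Sum>\<sigma> | \<sigma> permutes {..<n}. sign \<tau> * (if map_key \<sigma> (map_key \<tau> m) = \<alpha> then sign \<sigma> else 0))"
    by (rule sum.cong) (auto simp: map_key_perm_compose[OF _ \<tau>]
        sign_compose[OF permutes_imp_permutation[OF _ \<tau>] permutes_imp_permutation[of "{..<n}"]])
  also have "\<dots> = sign \<tau> * lookup (alternant n \<alpha>) (map_key \<tau> m)"
    unfolding lookup_alternant[OF \<alpha>] sum_distrib_left ..
  finally show "lookup (alternant n \<alpha>) (map_key \<tau> m) = sign \<tau> * lookup (alternant n \<alpha>) m"
    by simp
next
  fix m :: monomial assume m: "\<not> keys m \<subseteq> {..<n}"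
  have "map_key \<sigma> m \<noteq> \<alpha>" if "\<sigma> permutes {..<n}" for \<sigma>
    using keys_map_key_perm[OF that, of m] m \<alpha> by (auto simp: in_vec_def)
  then show "lookup (alternant n \<alpha>) m = 0"
    unfolding lookup_alternant[OF \<alpha>] by (intro sum.neutral) auto
qed

lemma splittings_map_key:
  assumes \<sigma>: "bij \<sigma>"
  shows "bij_betw (map_prod (map_key \<sigma>) (map_key \<sigma>)) (splittings m) (splittings (map_key \<sigma> m))"
proof (rule bij_betw_byWitness[where f' = "map_prod (map_key (inv_into UNIV \<sigma>)) (map_key (inv_into UNIV \<sigma>))"])
  show "\<forall>x\<in>splittings m. map_prod (map_key (inv_into UNIV \<sigma>)) (map_key (inv_into UNIV \<sigma>)) (map_prod (map_key \<sigma>) (map_key \<sigma>) x) = x"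
    by (auto simp: map_key_bij_inv(1)[OF \<sigma>])
  show "\<forall>x\<in>splittings (map_key \<sigma> m). map_prod (map_key \<sigma>) (map_key \<sigma>) (map_prod (map_key (inv_into UNIV \<sigma>)) (map_key (inv_into UNIV \<sigma>)) x) = x"
    by (auto simp: map_key_bij_inv(2)[OF \<sigma>])
  show "map_prod (map_key \<sigma>) (map_key \<sigma>) ` splittings m \<subseteq> splittings (map_key \<sigma> m)"
    by (auto simp: splittings_def simp flip: map_key_bij_add[OF \<sigma>])
  show "map_prod (map_key (inv_into UNIV \<sigma>)) (map_key (inv_into UNIV \<sigma>)) ` splittings (map_key \<sigma> m) \<subseteq> splittings m"
    by (auto simp: splittings_def map_key_bij_inv(1)[OF \<sigma>] simp flip: map_key_bij_add[OF bij_imp_bij_inv[OF \<sigma>]])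
qed

text \<open>What makes a_\<delta> f accessible: it is again antisymmetric, hence determined by its
  coefficients at the exponents \<delta> + \<nu>.\<close>

lemma alternating_times_specialise:
  assumes g: "alternating n g"
  shows "alternating n (g * specialise n f)"
  unfolding alternating_def
proof (intro conjI allI impI)
  fix \<sigma> and m :: monomial
  assume \<sigma>: "\<sigma> permutes {..<n}"
  have *: "lookup g (map_key \<sigma> a) = sign \<sigma> * lookup g a"
    "lookup (specialise n f) (map_key \<sigma> a) = lookup (specialise n f) a" for a
    using g \<sigma> by (auto simp: alternating_def lookup_specialise keys_map_key_perm coef_map_key permutes_bij)
  have "lookup (g * specialise n f) (map_key \<sigma> m) =
     (\<Sum>x\<in>splittings m. case map_prod (map_key \<sigma>) (map_key \<sigma>) x of (a, b) \<Rightarrow> lookup g a * lookup (specialise n f) b)"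
    unfolding lookup_times by (rule sum.reindex_bij_betw[OF splittings_map_key[OF permutes_bij[OF \<sigma>]], symmetric])
  also have "\<dots> = sign \<sigma> * lookup (g * specialise n f) m"
    unfolding lookup_times sum_distrib_left by (rule sum.cong) (auto simp: *)
  finally show "lookup (g * specialise n f) (map_key \<sigma> m) = sign \<sigma> * lookup (g * specialise n f) m" .
next
  fix m :: monomial assume m: "\<not> keys m \<subseteq> {..<n}"
  then have "\<not> (keys a \<subseteq> {..<n} \<and> keys b \<subseteq> {..<n})" if "(a, b) \<in> splittings m" for a b
    using that by (auto simp: splittings_def keys_add_nat)
  moreover have "lookup g a = 0" if "\<not> keys a \<subseteq> {..<n}" for a
    using g that by (auto simp: alternating_def)
  ultimately have "lookup g a = 0 \<or> lookup (specialise n f) b = 0" if "(a, b) \<in> splittings m" for a b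
    using that unfolding lookup_specialise by metis
  then show "lookup (g * specialise n f) m = 0"
    unfolding lookup_times by (intro sum.neutral) auto
qed

lemma alternating_sum:
  "(\<And>x. x \<in> A \<Longrightarrow> alternating n (g x)) \<Longrightarrow> alternating n (sum g A)"
  by (induction A rule: infinite_finite_induct)
    (auto simp: alternating_def lookup_add algebra_simps)

lemma alternating_diff:
  "alternating n f \<Longrightarrow> alternating n g \<Longrightarrow> alternating n (f - g)"
  by (auto simp: alternating_def lookup_minus algebra_simps)

lemma alternating_of_int_mult:
  "alternating n f \<Longrightarrow> alternating n (of_int z * f)"
  by (auto simp: alternating_def lookup_of_int_mult)

text \<open>Strict growth keeps \<open>f i\<close> at least i when counting from the left end and at
  most i when counting from the right end. Increasing index maps met below are thereby forced to be
  the identity.\<close>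

lemma strict_mono_on_eq_self:
  fixes f :: "nat \<Rightarrow> nat"
  assumes lt: "\<And>i. Suc i < n \<Longrightarrow> f i < f (Suc i)" and bd: "\<And>i. i < n \<Longrightarrow> f i < n" and i: "i < n"
  shows "f i = i"
proof -
  have "i \<le> f i" using i
  proof (induction i)
    case (Suc i)
    then show ?case using lt[of i] by simp
  qed simp
  moreover have "f (n - 1 - k) + k < n" if "k < n" for k using that
  proof (induction k)
    case 0 then show ?case using bd[of "n - 1"] by simp
  next
    case (Suc k)
    have "f (n - 1 - Suc k) < f (Suc (n - 1 - Suc k))" using Suc.prems by (intro lt) simp
    also have "Suc (n - 1 - Suc k) = n - 1 - k" using Suc.prems by simp
    finally show ?case using Suc by simp
  qed
  from this[of "n - 1 - i"] have "f i \<le> i" using i by simp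
  ultimately show ?thesis by simp
qed

lemma lookup_staircase: "lookup (staircase n) i = (if i < n then n - 1 - i else 0)"
  by (simp add: staircase.rep_eq)

lemma in_vec_staircase: "in_vec n (staircase n)"
  by (auto simp: in_vec_def in_keys_iff lookup_staircase split: if_splits)

lemma in_vec_add: "in_vec n (a + b) \<longleftrightarrow> in_vec n a \<and> in_vec n b"
  by (auto simp: in_vec_def keys_add_nat)

lemma partition_antimono: "is_partition \<alpha> \<Longrightarrow> i \<le> j \<Longrightarrow> lookup \<alpha> j \<le> lookup \<alpha> i"
  by (rule lift_Suc_antimono_le) (auto simp: is_partition_def)

text \<open>Both exponents decrease strictly, so a permutation that carries one to the other
  preserves the order of the indices and must be the identity.\<close>

lemma lookup_alternant_strict:
  assumes "is_partition \<kappa>" "is_partition \<nu>" "in_vec n \<kappa>" "in_vec n \<nu>"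
  shows "lookup (alternant n (staircase n + \<kappa>)) (staircase n + \<nu>) = (if \<kappa> = \<nu> then 1 else 0)"
proof -
  have dec: "lookup (staircase n + \<alpha>) j < lookup (staircase n + \<alpha>) i"
    if "is_partition \<alpha>" "i < j" "j < n" for \<alpha> i j
    using partition_antimono[OF that(1), of i j] that by (simp add: lookup_add lookup_staircase)
  have "\<sigma> = id \<and> \<nu> = \<kappa>" if \<sigma>: "\<sigma> permutes {..<n}" and eq: "map_key \<sigma> (staircase n + \<nu>) = staircase n + \<kappa>" for \<sigma>
  proof -
    have eq': "lookup (staircase n + \<nu>) (\<sigma> i) = lookup (staircase n + \<kappa>) i" for i
      using arg_cong[OF eq, of "\<lambda>m. lookup m i"] by (simp only: lookup_map_key_perm[OF \<sigma>])
    have bd: "\<sigma> i < n" if "i < n" for i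
      using permutes_in_image[OF \<sigma>, of i] that by simp
    have lt: "\<sigma> i < \<sigma> (Suc i)" if "Suc i < n" for i
    proof (rule ccontr)
      assume "\<not> \<sigma> i < \<sigma> (Suc i)"
      moreover have "\<sigma> i \<noteq> \<sigma> (Suc i)" using inj_eq[OF permutes_inj[OF \<sigma>], of i "Suc i"] by simp
      ultimately have "\<sigma> (Suc i) < \<sigma> i" by simp
      then have "lookup (staircase n + \<nu>) (\<sigma> i) < lookup (staircase n + \<nu>) (\<sigma> (Suc i))"
        using that by (intro dec assms bd) simp_all
      moreover have "lookup (staircase n + \<kappa>) (Suc i) < lookup (staircase n + \<kappa>) i"
        using that by (intro dec assms) simp_all
      ultimately show False by (simp add: eq')
    qed
    have "\<sigma> i = i" for i
      using strict_mono_on_eq_self[of n \<sigma> i] lt bd permutes_not_in[OF \<sigma>, of i] by (cases "i < n") auto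
    then have "\<sigma> = id" by auto
    then show ?thesis using eq' by (auto intro!: poly_mapping_eqI simp: lookup_add)
  qed
  moreover have "map_key id x = x" for x :: monomial
    using map_key_id[of x] by (simp add: id_def)
  ultimately have "(if map_key \<sigma> (staircase n + \<nu>) = staircase n + \<kappa> then sign \<sigma> else 0)
      = (if \<sigma> = id then if \<kappa> = \<nu> then 1 else 0 else 0)" if "\<sigma> permutes {..<n}" for \<sigma>
    using that by (metis sign_id)
  then have "lookup (alternant n (staircase n + \<kappa>)) (staircase n + \<nu>) =
     (\<Sum>\<sigma> | \<sigma> permutes {..<n}. if \<sigma> = id then if \<kappa> = \<nu> then 1 else 0 else 0)"
    using assms by (subst lookup_alternant) (auto simp: in_vec_add in_vec_staircase)
  also have "\<dots> = (if \<kappa> = \<nu> then 1 else 0)"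
    by (simp add: finite_permutations permutes_id)
  finally show ?thesis .
qed

text \<open>An exponent with a repeated entry has coefficient zero by antisymmetry, and any other
  one can be sorted into \<delta> + \<nu> at the cost of a sign. Expansions into alternants are
  verified through this.\<close>

lemma alternating_eq_0:
  assumes g: "alternating n g"
    and z: "\<And>\<nu>. is_partition \<nu> \<Longrightarrow> in_vec n \<nu> \<Longrightarrow> lookup g (staircase n + \<nu>) = 0"
  shows "g = 0"
proof (rule poly_mapping_eqI)
  fix m
  have "lookup g m = 0"
  proof (cases "keys m \<subseteq> {..<n}")
    case False
    then show ?thesis using g by (auto simp: alternating_def)
  next
    case m: True
    show ?thesis
    proof (cases "inj_on (lookup m) {..<n}")
      case False
      then obtain i j where ij: "i < n" "j < n" "i \<noteq> j" "lookup m i = lookup m j"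
        by (auto simp: inj_on_def)
      \<comment> \<open>The transposition fixes \<open>m\<close> and has sign -1, so the coefficient
        is its own negative.\<close>
      let ?t = "Transposition.transpose i j"
      have t: "?t permutes {..<n}" using ij by (intro permutes_swap_id) auto
      have "map_key ?t m = m"
        using ij by (intro poly_mapping_eqI) (auto simp: lookup_map_key_perm[OF t] Transposition.transpose_def)
      moreover have "lookup g (map_key ?t m) = sign ?t * lookup g m"
        using g t by (auto simp: alternating_def)
      ultimately show ?thesis using ij by (simp add: sign_swap_id)
    next
      case inj: True
      let ?ys = "map (lookup m) [0..<n]"
      obtain \<sigma> where \<sigma>: "\<sigma> permutes {..<length ?ys}" "permute_list \<sigma> ?ys = rev (sort ?ys)"
        by (rule mset_eq_permutation[of "rev (sort ?ys)" ?ys]) auto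
      then have \<sigma>n: "\<sigma> permutes {..<n}" by simp
      have bd: "\<sigma> i < n" if "i < n" for i
        using permutes_in_image[OF \<sigma>n, of i] that by simp
      have xs: "rev (sort ?ys) ! i = lookup m (\<sigma> i)" if "i < n" for i
        using that bd[OF that] unfolding \<sigma>(2)[symmetric] by (simp add: permute_list_nth[OF \<sigma>(1)])
      have dec: "lookup m (\<sigma> j) < lookup m (\<sigma> i)" if "i < j" "j < n" for i j
      proof -
        have "rev (sort ?ys) ! j \<le> rev (sort ?ys) ! i"
          using that by (intro sorted_rev_nth_mono) auto
        moreover have "lookup m (\<sigma> j) \<noteq> lookup m (\<sigma> i)"
          using inj_onD[OF inj, of "\<sigma> i" "\<sigma> j"] that bd[of i] bd[of j] inj_eq[OF permutes_inj[OF \<sigma>n], of i j]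
          by auto
        ultimately show ?thesis using that by (simp add: xs)
      qed
      \<comment> \<open>Distinct naturals in decreasing order dominate the staircase, which makes
        the truncated subtraction in \<open>\<nu>\<close> exact.\<close>
      have ge: "n - 1 - i \<le> lookup m (\<sigma> i)" if "i < n" for i
      proof -
        have "k \<le> lookup m (\<sigma> (n - 1 - k))" if "k < n" for k using that
        proof (induction k)
          case (Suc k)
          have "lookup m (\<sigma> (n - 1 - k)) < lookup m (\<sigma> (n - 1 - Suc k))"
            using Suc.prems by (intro dec) linarith+
          then show ?case using Suc by simp
        qed simp
        from this[of "n - 1 - i"] show ?thesis using that by simp
      qed
      define \<nu> where "\<nu> = map_key \<sigma> m - staircase n"
      have l\<nu>: "lookup \<nu> i = (if i < n then lookup m (\<sigma> i) - (n - 1 - i) else 0)" for i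
      proof -
        have "lookup m (\<sigma> i) = 0" if "\<not> i < n"
          using m that permutes_not_in[OF \<sigma>n, of i] by (auto simp: in_keys_iff subset_iff)
        then show ?thesis
          by (simp add: \<nu>_def lookup_minus lookup_map_key_perm[OF \<sigma>n] lookup_staircase)
      qed
      have "map_key \<sigma> m = staircase n + \<nu>"
      proof (rule poly_mapping_eqI)
        fix i
        show "lookup (map_key \<sigma> m) i = lookup (staircase n + \<nu>) i"
          using ge[of i] by (simp add: \<nu>_def lookup_minus lookup_map_key_perm[OF \<sigma>n] lookup_staircase lookup_add)
      qed
      moreover have "is_partition \<nu>"
        unfolding is_partition_def
      proof
        fix i show "lookup \<nu> (Suc i) \<le> lookup \<nu> i"
          using dec[of i "Suc i"] by (auto simp: l\<nu>)
      qed
      moreover have "in_vec n \<nu>"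
        by (auto simp: in_vec_def in_keys_iff l\<nu> split: if_splits)
      ultimately have "lookup g (map_key \<sigma> m) = 0" by (simp only: z)
      then have "sign \<sigma> * lookup g m = 0" using g \<sigma>n by (auto simp: alternating_def)
      then show ?thesis by simp
    qed
  qed
  then show "lookup g m = lookup 0 m" by simp
qed

section \<open>Horizontal strips and determinants of elementary symmetric functions\<close>

lemma downset_nat_eq:
  fixes A :: "nat set"
  assumes "finite A" "\<And>i j. j \<in> A \<Longrightarrow> i \<le> j \<Longrightarrow> i \<in> A"
  shows "A = {..<card A}"
proof -
  define k where "k = (LEAST i. i \<notin> A)"
  have "\<exists>i. i \<notin> A" using ex_new_if_finite[OF infinite_UNIV_nat assms(1)] .
  then have "k \<notin> A" unfolding k_def by (rule LeastI_ex)
  then have "A = {..<k}"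
    using assms(2) not_less_Least[of _ "\<lambda>i. i \<notin> A"] unfolding k_def[symmetric]
    by (auto simp: not_less[symmetric])
  then show ?thesis by simp
qed

lemma lookup_transpose: "lookup (transpose_part \<alpha>) j = card {i. j < lookup \<alpha> i}"
  by (simp add: transpose_part.rep_eq)

lemma finite_less_lookup: "finite {i. (j :: nat) < lookup \<alpha> i}"
  by (rule finite_subset[of _ "keys \<alpha>"]) (auto simp: in_keys_iff)

text \<open>For a partition the rows longer than j form an initial segment, so membership and
  cardinality say the same. In this symmetric form, facts about transposes follow by
  rewriting.\<close>

lemma less_transpose_iff:
  assumes "is_partition \<alpha>"
  shows "i < lookup (transpose_part \<alpha>) j \<longleftrightarrow> j < lookup \<alpha> i"
proof -
  have "{i. j < lookup \<alpha> i} = {..<card {i. j < lookup \<alpha> i}}"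
    by (rule downset_nat_eq[OF finite_less_lookup])
      (auto intro: less_le_trans partition_antimono[OF assms])
  then show ?thesis
    unfolding lookup_transpose by blast
qed

lemma is_partition_transpose: "is_partition (transpose_part \<alpha>)"
  unfolding is_partition_def lookup_transpose
  by (auto intro!: card_mono finite_less_lookup)

lemma nat_eqI_less: "(\<And>k::nat. k < a \<longleftrightarrow> k < b) \<Longrightarrow> a = b"
  by (meson less_irrefl nat_neq_iff)

lemma transpose_transpose:
  assumes "is_partition \<alpha>"
  shows "transpose_part (transpose_part \<alpha>) = \<alpha>"
  by (intro poly_mapping_eqI nat_eqI_less)
    (simp add: less_transpose_iff is_partition_transpose assms)

lemma transpose_eq_0:
  assumes "is_partition \<alpha>" "lookup \<alpha> 0 \<le> r" "r \<le> j"
  shows "lookup (transpose_part \<alpha>) j = 0"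
  using less_transpose_iff[OF assms(1), of 0 j] assms(2,3) by simp

lemma mono_degree_superset:
  "finite A \<Longrightarrow> keys m \<subseteq> A \<Longrightarrow> mono_degree m = (\<Sum>i\<in>A. lookup m i)"
  unfolding mono_degree_def by (rule sum.mono_neutral_left) (auto simp: in_keys_iff)

text \<open>Both sides count the boxes of the diagram, by columns and by rows; the bound r ensures
  that no column is missed.\<close>

lemma mono_degree_transpose:
  assumes "is_partition \<alpha>" "lookup \<alpha> 0 \<le> r"
  shows "(\<Sum>j<r. lookup (transpose_part \<alpha>) j) = mono_degree \<alpha>"
proof -
  have "(\<Sum>j<r. lookup (transpose_part \<alpha>) j) = (\<Sum>j<r. \<Sum>i\<in>keys \<alpha>. if j < lookup \<alpha> i then 1 else 0)"
  proof (rule sum.cong[OF refl])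
    fix j
    have "{i. j < lookup \<alpha> i} = {i \<in> keys \<alpha>. j < lookup \<alpha> i}"
      by (auto simp: in_keys_iff)
    then show "lookup (transpose_part \<alpha>) j = (\<Sum>i\<in>keys \<alpha>. if j < lookup \<alpha> i then 1 else 0)"
      unfolding lookup_transpose by (simp flip: sum.inter_filter)
  qed
  also have "\<dots> = (\<Sum>i\<in>keys \<alpha>. \<Sum>j<r. if j < lookup \<alpha> i then 1 else 0)"
    by (rule sum.swap)
  also have "\<dots> = (\<Sum>i\<in>keys \<alpha>. lookup \<alpha> i)"
  proof (rule sum.cong[OF refl])
    fix i
    have "{j \<in> {..<r}. j < lookup \<alpha> i} = {..<lookup \<alpha> i}"
      using partition_antimono[OF assms(1), of 0 i] assms(2) by auto
    then show "(\<Sum>j<r. if j < lookup \<alpha> i then 1 else 0) = lookup \<alpha> i"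
      by (simp flip: sum.inter_filter)
  qed
  finally show ?thesis by (simp add: mono_degree_def)
qed

text \<open>Interlacing of rows: row i + 1 of \<alpha> ends no later than row i of \<kappa>, so
  \<alpha>/\<kappa> has at most one box in each column.\<close>

definition hstrips :: "composition \<Rightarrow> composition set" where
  "hstrips \<alpha> = {\<kappa>. is_partition \<kappa> \<and>
     (\<forall>i. lookup \<kappa> i \<le> lookup \<alpha> i \<and> lookup \<alpha> (Suc i) \<le> lookup \<kappa> i)}"

lemma mono_degree_mono:
  assumes "\<And>i. lookup \<kappa> i \<le> lookup \<alpha> i"
  shows "mono_degree \<kappa> \<le> mono_degree \<alpha>"
proof -
  have "keys \<kappa> \<subseteq> keys \<alpha>" using assms by (auto simp: in_keys_iff intro: less_le_trans[OF _ assms])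
  then have "mono_degree \<kappa> = (\<Sum>i\<in>keys \<alpha>. lookup \<kappa> i)"
    by (intro mono_degree_superset) auto
  also have "\<dots> \<le> mono_degree \<alpha>" unfolding mono_degree_def by (intro sum_mono assms)
  finally show ?thesis .
qed

text \<open>Seen by columns, a strip takes zero or one box from each. This form meets the binary
  choices in the rows of the determinant, while the row form meets alternants and the Pieri
  rule.\<close>

lemma hstrips_iff_transpose:
  assumes \<alpha>: "is_partition \<alpha>" and \<kappa>: "is_partition \<kappa>"
  shows "\<kappa> \<in> hstrips \<alpha> \<longleftrightarrow>
    (\<forall>j. lookup (transpose_part \<kappa>) j \<le> lookup (transpose_part \<alpha>) j \<and>
         lookup (transpose_part \<alpha>) j \<le> Suc (lookup (transpose_part \<kappa>) j))"
proof -
  note lt = less_transpose_iff[OF \<alpha>] less_transpose_iff[OF \<kappa>]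
  have "(\<forall>i. lookup \<kappa> i \<le> lookup \<alpha> i) \<longleftrightarrow>
    (\<forall>j. lookup (transpose_part \<kappa>) j \<le> lookup (transpose_part \<alpha>) j)"
  proof -
    have le: "a \<le> b \<longleftrightarrow> (\<forall>k. k < a \<longrightarrow> k < b)" for a b :: nat
      using less_le_trans not_less by blast
    show ?thesis unfolding le lt by blast
  qed
  moreover have "(\<forall>i. lookup \<alpha> (Suc i) \<le> lookup \<kappa> i) \<longleftrightarrow>
    (\<forall>j. lookup (transpose_part \<alpha>) j \<le> Suc (lookup (transpose_part \<kappa>) j))"
  proof (intro iffI allI)
    fix j assume *: "\<forall>i. lookup \<alpha> (Suc i) \<le> lookup \<kappa> i"
    have "\<not> j < lookup \<kappa> (lookup (transpose_part \<kappa>) j)" by (simp flip: lt)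
    then have "\<not> j < lookup \<alpha> (Suc (lookup (transpose_part \<kappa>) j))"
      using *[rule_format, of "lookup (transpose_part \<kappa>) j"] by simp
    then show "lookup (transpose_part \<alpha>) j \<le> Suc (lookup (transpose_part \<kappa>) j)"
      by (simp flip: lt)
  next
    fix i assume *: "\<forall>j. lookup (transpose_part \<alpha>) j \<le> Suc (lookup (transpose_part \<kappa>) j)"
    have "\<not> i < lookup (transpose_part \<kappa>) (lookup \<kappa> i)" by (simp add: lt)
    then have "\<not> Suc i < lookup (transpose_part \<alpha>) (lookup \<kappa> i)"
      using *[rule_format, of "lookup \<kappa> i"] by simp
    then show "lookup \<alpha> (Suc i) \<le> lookup \<kappa> i"
      by (simp add: lt)
  qed
  ultimately show ?thesis using \<kappa> by (auto simp: hstrips_def)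
qed

lemma finite_hstrips: "finite (hstrips \<alpha>)"
proof (rule finite_subset)
  have "0 < lookup \<alpha> i" if "\<kappa> \<in> hstrips \<alpha>" "0 < lookup \<kappa> i" for \<kappa> i
    using that by (auto simp: hstrips_def intro: less_le_trans)
  then show "hstrips \<alpha> \<subseteq> {m. keys m \<subseteq> keys \<alpha> \<and> (\<forall>i. lookup m i \<le> mono_degree \<alpha>)}"
    by (auto simp: hstrips_def in_keys_iff intro: order_trans[OF _ lookup_le_mono_degree])
qed (simp add: finite_bounded_monomials)

section \<open>Expanding determinants of elementary symmetric functions by rows\<close>

lift_definition vec_of :: "nat \<Rightarrow> (nat \<Rightarrow> nat) \<Rightarrow> composition" is
  "\<lambda>n f i. if i < n then f i else 0"
  by (rule finite_subset[of _ "{..<_}"]) (auto split: if_splits)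

lemma lookup_vec_of: "lookup (vec_of n f) i = (if i < n then f i else 0)"
  by (simp add: vec_of.rep_eq)

lemma in_vec_vec_of: "in_vec n (vec_of n f)"
  by (auto simp: in_vec_def in_keys_iff lookup_vec_of split: if_splits)

text \<open>Multilinearity in the rows. The coefficients \<open>c\<close> are kept apart from the
  entries so that powers of the last variable come out in front of each determinant.\<close>

lemma det_sum_rows:
  fixes c :: "nat \<Rightarrow> 'i \<Rightarrow> 'a :: comm_ring_1"
  assumes "\<And>i. i < n \<Longrightarrow> finite (M i)"
  shows "det (mat n n (\<lambda>(i, j). \<Sum>m\<in>M i. c i m * A i m j)) =
    (\<Sum>f\<in>Pi\<^sub>E {..<n} M. (\<Prod>i<n. c i (f i)) * det (mat n n (\<lambda>(i, j). A i (f i) j)))"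
proof -
  let ?P = "{p. p permutes {0..<n}}"
  have "det (mat n n (\<lambda>(i, j). \<Sum>m\<in>M i. c i m * A i m j)) =
    (\<Sum>p\<in>?P. signof p * (\<Prod>i<n. \<Sum>m\<in>M i. c i m * A i m (p i)))"
    by (subst det_def'[of _ n]) (auto intro!: sum.cong prod.cong simp: atLeast0LessThan permutes_in_image[of _ "{..<n}", simplified])
  also have "\<dots> = (\<Sum>p\<in>?P. \<Sum>f\<in>Pi\<^sub>E {..<n} M.
      (\<Prod>i<n. c i (f i)) * (signof p * (\<Prod>i<n. A i (f i) (p i))))"
    using assms by (subst prod_sum_PiE)
      (simp_all add: sum_distrib_left prod.distrib algebra_simps)
  also have "\<dots> = (\<Sum>f\<in>Pi\<^sub>E {..<n} M. (\<Prod>i<n. c i (f i)) *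
      (\<Sum>p\<in>?P. signof p * (\<Prod>i<n. A i (f i) (p i))))"
    by (subst sum.swap) (simp add: sum_distrib_left)
  also have "\<dots> = (\<Sum>f\<in>Pi\<^sub>E {..<n} M. (\<Prod>i<n. c i (f i)) * det (mat n n (\<lambda>(i, j). A i (f i) j)))"
  proof -
    have "(\<Sum>p\<in>?P. signof p * (\<Prod>i<n. A i (f i) (p i))) = det (mat n n (\<lambda>(i, j). A i (f i) j))" for f
      by (subst det_def'[of _ n]) (auto intro!: sum.cong prod.cong simp: atLeast0LessThan permutes_in_image[of _ "{..<n}", simplified])
    then show ?thesis by simp
  qed
  finally show ?thesis .
qed

lemma det_zero_row:
  fixes A :: "'a :: comm_ring_1 mat"
  assumes A: "A \<in> carrier_mat n n" and i: "i < n" and z: "\<And>j. j < n \<Longrightarrow> A $$ (i, j) = 0"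
  shows "det A = 0"
  unfolding det_def'[OF A]
proof (rule sum.neutral, rule ballI)
  fix p assume "p \<in> {p. p permutes {0..<n}}"
  then have "p i < n" using permutes_in_image[of p "{0..<n}" i] i by simp
  then have "(\<Prod>i = 0..<n. A $$ (i, p i)) = 0"
    using i z by (intro prod_zero bexI[of _ i]) auto
  then show "signof p * (\<Prod>i = 0..<n. A $$ (i, p i)) = 0" by simp
qed

text \<open>Row shifts are arbitrary integers because expanding the rows leads through sequences
  that belong to no partition.\<close>

definition edet :: "nat \<Rightarrow> (nat \<Rightarrow> int) \<Rightarrow> (nat \<Rightarrow> int) \<Rightarrow> symfun" where
  "edet r a b = det (mat r r (\<lambda>(i, j). elementary (a i - b j)))"

lemma coef_elementary_nat:
  "coef (elementary_nat d) m = (if (\<forall>i. lookup m i \<le> 1) \<and> mono_degree m = d then 1 else 0)"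
proof -
  have "index_sets d m = (if (\<forall>i. lookup m i \<le> 1) \<and> mono_degree m = d then {keys m} else {})"
  proof (cases "\<forall>i. lookup m i \<le> 1")
    case True
    have one: "lookup m i = (if i \<in> keys m then 1 else 0)" for i
      using True[rule_format, of i] by (auto simp: in_keys_iff)
    then have deg: "mono_degree m = card (keys m)"
      unfolding mono_degree_def by simp
    have "S \<in> index_sets d m \<longleftrightarrow> S = keys m \<and> d = card (keys m)" for S
    proof
      assume S: "S \<in> index_sets d m"
      then have "S = keys m"
        by (auto simp: index_sets_iff in_keys_iff split: if_splits)
      with S show "S = keys m \<and> d = card (keys m)"
        by (simp add: index_sets_iff)
    next
      assume "S = keys m \<and> d = card (keys m)"
      then show "S \<in> index_sets d m" using one by (simp add: index_sets_iff)
    qed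
    with True deg show ?thesis by auto
  next
    case False
    then obtain i where "1 < lookup m i" by (auto simp: not_le)
    then show ?thesis using False by (auto simp: index_sets_iff split: if_splits)
  qed
  then show ?thesis
    by (simp add: elementary_nat.rep_eq elementary_ps.rep_eq)
qed

lemma coef_elementary:
  "coef (elementary d) m = (if (\<forall>i. lookup m i \<le> 1) \<and> int (mono_degree m) = d then 1 else 0)"
  by (auto simp: elementary_def coef_elementary_nat coef_0)

text \<open>As q does not involve the last variable, the power in front accounts for its whole
  exponent; coefficients can thus be sorted by powers of that variable.\<close>

lemma lookup_X_power_times:
  assumes "\<And>m. \<not> keys m \<subseteq> {..<n} \<Longrightarrow> lookup q m = 0" and "keys y \<subseteq> {..<n}"
  shows "lookup (poly_X n ^ k * q) (y + single n l) = (if k = l then lookup q y else 0)"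
proof (cases "k = l")
  case True
  then show ?thesis
    unfolding poly_X_power by (simp add: add.commute[of y] lookup_monom_times)
next
  case False
  have ny: "lookup y n = 0" using assms(2) by (auto simp: in_keys_iff)
  show ?thesis
  proof (cases "k < l")
    case True
    have "y + single n l = single n k + (y + single n (l - k))"
      using True by (simp add: ac_simps flip: single_add)
    then have "lookup (poly_X n ^ k * q) (y + single n l) = lookup q (y + single n (l - k))"
      unfolding poly_X_power by (simp add: lookup_monom_times)
    also have "\<dots> = 0"
      using True by (intro assms(1)) (auto simp: keys_add_nat)
    finally show ?thesis using False by simp
  next
    case *: False
    have "y + single n l \<noteq> single n k + z" for z
      using ny False * by (auto simp: lookup_add dest!: arg_cong[of _ _ "\<lambda>m. lookup m n"])
    then show ?thesis
      unfolding poly_X_power using False by (simp add: lookup_monom_times_eq_0)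
  qed
qed

lemma split_last:
  fixes m :: monomial
  assumes "keys m \<subseteq> {..<Suc n}"
  obtains y where "m = y + single n (lookup m n)" "keys y \<subseteq> {..<n}"
proof
  let ?y = "m - single n (lookup m n)"
  show "m = ?y + single n (lookup m n)"
    by (rule poly_mapping_eqI) (auto simp: lookup_add lookup_minus lookup_single when_def)
  show "keys ?y \<subseteq> {..<n}"
    using assms by (auto simp: in_keys_iff lookup_minus lookup_single when_def subset_iff less_Suc_eq split: if_splits)
qed

lemma mono_degree_single: "mono_degree (single i k) = k"
  by (simp add: mono_degree_def)

lemma X_power_times_vars:
  assumes "\<And>m. \<not> keys m \<subseteq> {..<n} \<Longrightarrow> lookup q m = 0" "\<not> keys m \<subseteq> {..<Suc n}"
  shows "lookup (poly_X n ^ k * q) m = 0"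
proof (cases "\<exists>y. m = single n k + y")
  case True
  then obtain y where y: "m = single n k + y" by blast
  then have "\<not> keys y \<subseteq> {..<n}"
    using assms(2) by (auto simp: keys_add_nat lessThan_Suc split: if_splits)
  then show ?thesis
    unfolding y poly_X_power lookup_monom_times by (rule assms(1))
next
  case False
  then show ?thesis
    unfolding poly_X_power by (intro lookup_monom_times_eq_0) blast
qed

lemma poly_eq_last_varI:
  fixes p q :: mpoly_int
  assumes "\<And>m. \<not> keys m \<subseteq> {..<Suc n} \<Longrightarrow> lookup p m = lookup q m"
    and "\<And>y l. keys y \<subseteq> {..<n} \<Longrightarrow> lookup p (y + single n l) = lookup q (y + single n l)"
  shows "p = q"
proof (rule poly_mapping_eqI)
  fix m :: monomial
  show "lookup p m = lookup q m"
  proof (cases "keys m \<subseteq> {..<Suc n}")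
    case True
    obtain y where "m = y + single n (lookup m n)" "keys y \<subseteq> {..<n}"
      using split_last[OF True] .
    then show ?thesis using assms(2) by metis
  qed (rule assms(1))
qed

lemma specialise_Suc_elementary:
  "specialise (Suc n) (elementary d) =
    specialise n (elementary d) + poly_X n * specialise n (elementary (d - 1))"
proof (rule poly_eq_last_varI[of n])
  fix m :: monomial assume m: "\<not> keys m \<subseteq> {..<Suc n}"
  then have "\<not> keys m \<subseteq> {..<n}" by auto
  moreover have "lookup (poly_X n ^ 1 * specialise n (elementary (d - 1))) m = 0"
    by (rule X_power_times_vars[OF _ m]) (simp add: lookup_specialise)
  ultimately show "lookup (specialise (Suc n) (elementary d)) m =
      lookup (specialise n (elementary d) + poly_X n * specialise n (elementary (d - 1))) m"
    using m by (simp add: lookup_specialise lookup_add)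
next
  fix y :: monomial and l assume y: "keys y \<subseteq> {..<n}"
  have ny: "lookup y n = 0" using y by (auto simp: in_keys_iff)
  have k: "keys (y + single n l) \<subseteq> {..<Suc n}" "keys (y + single n l) \<subseteq> {..<n} \<longleftrightarrow> l = 0"
    using y by (auto simp: keys_add_nat)
  have "(\<forall>i. lookup (y + single n l) i \<le> 1) \<longleftrightarrow> (\<forall>i. lookup y i \<le> 1) \<and> l \<le> 1"
  proof -
    have "lookup (y + single n l) i = (if i = n then l else lookup y i)" for i
      using ny by (simp add: lookup_add lookup_single when_def)
    then show ?thesis using ny by auto
  qed
  moreover have "lookup (poly_X n * specialise n (elementary (d - 1))) (y + single n l) =
      (if 1 = l then lookup (specialise n (elementary (d - 1))) y else 0)"
    using lookup_X_power_times[of n "specialise n (elementary (d - 1))" y 1 l] y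
    by (simp add: lookup_specialise)
  ultimately show "lookup (specialise (Suc n) (elementary d)) (y + single n l) =
      lookup (specialise n (elementary d) + poly_X n * specialise n (elementary (d - 1))) (y + single n l)"
    using k y by (auto simp: lookup_specialise lookup_add coef_elementary mono_degree_add mono_degree_single)
qed

abbreviation sh :: "composition \<Rightarrow> nat \<Rightarrow> int" where
  "sh \<alpha> \<equiv> shifted_entry (transpose_part \<alpha>)"

lemma specialise_edet:
  "specialise n (edet r a b) = det (mat r r (\<lambda>(i, j). specialise n (elementary (a i - b j))))"
proof -
  have "map_mat (specialise n) (mat r r (\<lambda>(i, j). elementary (a i - b j))) =
      mat r r (\<lambda>(i, j). specialise n (elementary (a i - b j)))"
    by (rule eq_matI) auto
  then show ?thesis
    unfolding edet_def specialise.hom_det[symmetric] by simp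
qed

text \<open>\<open>f i = 1\<close> records that row i takes the term carrying the new variable,
  which lowers the index of that row by one.\<close>

lemma specialise_Suc_edet:
  "specialise (Suc n) (edet r a b) =
    (\<Sum>f\<in>{..<r} \<rightarrow>\<^sub>E {0, 1 :: nat}. poly_X n ^ (\<Sum>i<r. f i) * specialise n (edet r (\<lambda>i. a i - int (f i)) b))"
proof -
  have "specialise (Suc n) (elementary (a i - b j)) =
      (\<Sum>s\<in>{0, 1 :: nat}. poly_X n ^ s * specialise n (elementary (a i - int s - b j)))" for i j
    by (simp add: specialise_Suc_elementary algebra_simps)
  then have "specialise (Suc n) (edet r a b) = det (mat r r (\<lambda>(i, j).
      \<Sum>s\<in>{0, 1 :: nat}. poly_X n ^ s * specialise n (elementary (a i - int s - b j))))"
    unfolding specialise_edet by simp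
  also have "\<dots> = (\<Sum>f\<in>{..<r} \<rightarrow>\<^sub>E {0, 1 :: nat}. (\<Prod>i<r. poly_X n ^ f i) *
      det (mat r r (\<lambda>(i, j). specialise n (elementary (a i - int (f i) - b j)))))"
    by (rule det_sum_rows) simp
  finally show ?thesis
    by (simp add: specialise_edet power_sum)
qed

lemma edet_equal_rows:
  assumes "i < r" "k < r" "i \<noteq> k" "a i = a k"
  shows "edet r a b = 0"
  unfolding edet_def
  by (rule det_identical_rows[of _ r i k]) (use assms in \<open>auto intro!: eq_vecI\<close>)

lemma edet_zero_row:
  assumes "i < r" "\<And>j. j < r \<Longrightarrow> a i < b j"
  shows "edet r a b = 0"
  unfolding edet_def
  by (rule det_zero_row[of _ r i]) (use assms in \<open>auto simp: elementary_def\<close>)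

lemma sh_less: "i < j \<Longrightarrow> sh \<alpha> j < sh \<alpha> i"
  using partition_antimono[OF is_partition_transpose, of i j \<alpha>] by (simp add: shifted_entry_def)

lemma edet_cong: "(\<And>i. i < r \<Longrightarrow> a i = a' i) \<Longrightarrow> edet r a b = edet r a' b"
  unfolding edet_def by (intro arg_cong[of _ _ det] eq_matI) auto

lemma partition_eqI_transpose:
  assumes "is_partition \<alpha>" "is_partition \<beta>" "lookup \<alpha> 0 \<le> r" "lookup \<beta> 0 \<le> r"
    and "\<And>j. j < r \<Longrightarrow> lookup (transpose_part \<alpha>) j = lookup (transpose_part \<beta>) j"
  shows "\<alpha> = \<beta>"
proof -
  have "transpose_part \<alpha> = transpose_part \<beta>"
    using assms transpose_eq_0[of _ r] by (intro poly_mapping_eqI) (metis not_le)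
  then show ?thesis using assms transpose_transpose by metis
qed

text \<open>The surviving choices are the differences of the column lengths of \<alpha> and
  \<kappa>. Distinctness of rows keeps the lowered shifts strictly decreasing, hence the new column
  lengths weakly decreasing, and the bound on \<open>b\<close> keeps them nonnegative.\<close>

lemma specialise_Suc_edet_sh:
  assumes \<alpha>: "is_partition \<alpha>" "lookup \<alpha> 0 \<le> r" and b: "\<And>j. j < r \<Longrightarrow> - int r \<le> b j"
  shows "specialise (Suc n) (edet r (sh \<alpha>) b) =
    (\<Sum>\<kappa>\<in>hstrips \<alpha>. poly_X n ^ (mono_degree \<alpha> - mono_degree \<kappa>) * specialise n (edet r (sh \<kappa>) b))"
proof -
  let ?t = "\<lambda>\<alpha>. lookup (transpose_part \<alpha>)"
  \<comment> \<open>Marks the columns that lose a box; the restriction makes it an extensional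
    choice function on the rows.\<close>
  define \<phi> where "\<phi> \<kappa> = restrict (\<lambda>i. ?t \<alpha> i - ?t \<kappa> i) {..<r}" for \<kappa>
  let ?G = "\<lambda>f. poly_X n ^ (\<Sum>i<r. f i) * specialise n (edet r (\<lambda>i. sh \<alpha> i - int (f i)) b)"
  have H: "is_partition \<kappa>" "lookup \<kappa> 0 \<le> r" "?t \<kappa> j \<le> ?t \<alpha> j" "?t \<alpha> j \<le> Suc (?t \<kappa> j)"
    if "\<kappa> \<in> hstrips \<alpha>" for \<kappa> j
    using that \<alpha> hstrips_iff_transpose[OF \<alpha>(1), of \<kappa>]
    by (auto simp: hstrips_def intro: order_trans[of _ "lookup \<alpha> 0"])
  have inj: "inj_on \<phi> (hstrips \<alpha>)"
  proof (rule inj_onI)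
    fix \<kappa> \<kappa>' assume k: "\<kappa> \<in> hstrips \<alpha>" "\<kappa>' \<in> hstrips \<alpha>" and eq: "\<phi> \<kappa> = \<phi> \<kappa>'"
    have "?t \<kappa> j = ?t \<kappa>' j" if "j < r" for j
      using fun_cong[OF eq, of j] H(3)[OF k(1), of j] H(3)[OF k(2), of j] that by (simp add: \<phi>_def)
    then show "\<kappa> = \<kappa>'" using H(1,2)[OF k(1)] H(1,2)[OF k(2)] by (intro partition_eqI_transpose)
  qed
  have img: "\<phi> ` hstrips \<alpha> \<subseteq> {..<r} \<rightarrow>\<^sub>E {0, 1}"
  proof clarify
    fix \<kappa> assume "\<kappa> \<in> hstrips \<alpha>"
    have "b - a \<in> {0, 1}" if "a \<le> b" "b \<le> Suc a" for a b :: nat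
      using that by auto
    then have "?t \<alpha> i - ?t \<kappa> i \<in> {0, 1}" for i
      using H(3,4)[OF \<open>\<kappa> \<in> hstrips \<alpha>\<close>] .
    then show "\<phi> \<kappa> \<in> {..<r} \<rightarrow>\<^sub>E {0, 1}" by (auto simp: \<phi>_def)
  qed
  have zero: "?G f = 0" if f: "f \<in> {..<r} \<rightarrow>\<^sub>E {0, 1}" and nf: "f \<notin> \<phi> ` hstrips \<alpha>" for f
  proof (rule ccontr)
    assume nz: "?G f \<noteq> 0"
    then have e: "edet r (\<lambda>i. sh \<alpha> i - int (f i)) b \<noteq> 0" by (auto simp: specialise_0)
    have f01: "f i \<le> 1" if "i < r" for i using PiE_mem[OF f, of i] that by auto
    \<comment> \<open>Lowering by at most one can turn the strict inequality into an equality but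
      cannot reverse it, and equality would give two equal rows.\<close>
    have dec: "sh \<alpha> (Suc i) - int (f (Suc i)) < sh \<alpha> i - int (f i)" if "Suc i < r" for i
    proof -
      have "sh \<alpha> i - int (f i) \<noteq> sh \<alpha> (Suc i) - int (f (Suc i))"
        using edet_equal_rows[of i r "Suc i" "\<lambda>i. sh \<alpha> i - int (f i)" b] that e by auto
      then show ?thesis using sh_less[of i "Suc i" \<alpha>] f01[of i] that by auto
    qed
    define g where "g i = ?t \<alpha> i - f i" for i
    have fle: "f i \<le> ?t \<alpha> i" if i: "i < r" for i
    proof -
      \<comment> \<open>Nonnegativity is settled in the last row and carried to earlier rows by
        strict decrease, so the induction counts rows from the end.\<close>
      have "k < r \<Longrightarrow> int (f (r - 1 - k)) \<le> int (?t \<alpha> (r - 1 - k))" for k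
      proof (induction k)
        case 0
        show ?case
        proof (rule ccontr)
          \<comment> \<open>Otherwise the last row drops below every \<open>b j\<close>, so that all its entries vanish.\<close>
          assume "\<not> ?case"
          then have "sh \<alpha> (r - 1) - int (f (r - 1)) < - int r"
            using 0 f01[of "r - 1"] by (simp add: shifted_entry_def of_nat_diff)
          then have "edet r (\<lambda>i. sh \<alpha> i - int (f i)) b = 0"
            using 0 by (intro edet_zero_row[of "r - 1"]) (auto intro: less_le_trans b)
          with e show False by simp
        qed
      next
        case (Suc k)
        then have "Suc (r - 1 - Suc k) = r - 1 - k" by linarith
        then show ?case using dec[of "r - 1 - Suc k"] Suc by (simp add: shifted_entry_def)
      qed
      from this[of "r - 1 - i"] i show ?thesis by simp
    qed
    let ?\<gamma> = "vec_of r g"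
    have \<gamma>: "is_partition ?\<gamma>"
      unfolding is_partition_def
    proof
      fix i
      show "lookup ?\<gamma> (Suc i) \<le> lookup ?\<gamma> i"
        using dec[of i] fle[of i] fle[of "Suc i"]
        by (auto simp: lookup_vec_of g_def shifted_entry_def)
    qed
    define \<kappa> where "\<kappa> = transpose_part ?\<gamma>"
    have t\<kappa>: "?t \<kappa> j = (if j < r then ?t \<alpha> j - f j else 0)" for j
      unfolding \<kappa>_def transpose_transpose[OF \<gamma>] by (simp add: lookup_vec_of g_def)
    have "is_partition \<kappa>" unfolding \<kappa>_def by (rule is_partition_transpose)
    then have "\<kappa> \<in> hstrips \<alpha>"
    proof (subst hstrips_iff_transpose[OF \<alpha>(1)], simp, intro allI)
      fix j
      show "?t \<kappa> j \<le> ?t \<alpha> j \<and> ?t \<alpha> j \<le> Suc (?t \<kappa> j)"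
      proof (cases "j < r")
        case True
        have "?t \<kappa> j = ?t \<alpha> j - f j" using True by (simp add: t\<kappa>)
        then show ?thesis using f01[OF True] by linarith
      next
        case False
        then show ?thesis using transpose_eq_0[OF \<alpha>, of j] by (simp add: t\<kappa>)
      qed
    qed
    moreover have "\<phi> \<kappa> = f"
    proof
      fix i show "\<phi> \<kappa> i = f i"
        using fle[of i] PiE_arb[OF f, of i] by (auto simp: \<phi>_def t\<kappa>)
    qed
    ultimately show False using nf by blast
  qed
  have "specialise (Suc n) (edet r (sh \<alpha>) b) = sum ?G ({..<r} \<rightarrow>\<^sub>E {0, 1})"
    by (rule specialise_Suc_edet)
  also have "\<dots> = sum ?G (\<phi> ` hstrips \<alpha>)"
    using img zero by (intro sum.mono_neutral_right) (auto intro!: finite_PiE)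
  also have "\<dots> = (\<Sum>\<kappa>\<in>hstrips \<alpha>. ?G (\<phi> \<kappa>))"
    using inj by (subst sum.reindex) simp_all
  also have "\<dots> = (\<Sum>\<kappa>\<in>hstrips \<alpha>. poly_X n ^ (mono_degree \<alpha> - mono_degree \<kappa>) * specialise n (edet r (sh \<kappa>) b))"
  proof (rule sum.cong[OF refl])
    fix \<kappa> assume k: "\<kappa> \<in> hstrips \<alpha>"
    have "(\<Sum>i<r. \<phi> \<kappa> i) = (\<Sum>i<r. ?t \<alpha> i) - (\<Sum>i<r. ?t \<kappa> i)"
      using H(3)[OF k] by (subst sum_subtractf_nat[symmetric]) (auto simp: \<phi>_def)
    then have "(\<Sum>i<r. \<phi> \<kappa> i) = mono_degree \<alpha> - mono_degree \<kappa>"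
      using \<alpha> H(1,2)[OF k] by (simp add: mono_degree_transpose)
    moreover have "edet r (\<lambda>i. sh \<alpha> i - int (\<phi> \<kappa> i)) b = edet r (sh \<kappa>) b"
      using H(3)[OF k] by (intro edet_cong) (simp add: \<phi>_def shifted_entry_def of_nat_diff)
    ultimately show "?G (\<phi> \<kappa>) = poly_X n ^ (mono_degree \<alpha> - mono_degree \<kappa>) * specialise n (edet r (sh \<kappa>) b)"
      by simp
  qed
  finally show ?thesis .
qed

lemma specialise_0_elementary: "specialise 0 (elementary d) = (if d = 0 then 1 else 0)"
  by (rule poly_mapping_eqI)
    (auto simp: lookup_specialise coef_elementary lookup_one when_def mono_degree_def)

text \<open>Without variables only e_0 survives, so the matrix marks the coincidences of two
  strictly decreasing sequences. If no row is zero, they define an increasing map of the indices,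
  which is the identity.\<close>

lemma specialise_0_edet_sh:
  assumes "is_partition \<alpha>" "is_partition \<beta>" "lookup \<alpha> 0 \<le> r" "lookup \<beta> 0 \<le> r"
  shows "specialise 0 (edet r (sh \<alpha>) (sh \<beta>)) = (if \<alpha> = \<beta> then 1 else 0)"
proof -
  let ?A = "mat r r (\<lambda>(i, j). if sh \<alpha> i = sh \<beta> j then 1 else 0 :: mpoly_int)"
  have sp: "specialise 0 (edet r (sh \<alpha>) (sh \<beta>)) = det ?A"
    unfolding specialise_edet specialise_0_elementary by simp
  have inj: "sh \<gamma> i = sh \<gamma> j \<longleftrightarrow> i = j" for \<gamma> i j
    using sh_less[of i j \<gamma>] sh_less[of j i \<gamma>] by (cases i j rule: linorder_cases) auto
  show ?thesis
  proof (cases "\<alpha> = \<beta>")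
    case True
    then have "?A = 1\<^sub>m r" by (intro eq_matI) (auto simp: inj)
    then show ?thesis using True sp by simp
  next
    case False
    have "det ?A = 0"
    proof (rule ccontr)
      assume "det ?A \<noteq> 0"
      have "\<exists>j<r. sh \<alpha> i = sh \<beta> j" if "i < r" for i
      proof (rule ccontr)
        assume "\<not> ?thesis"
        then have "det ?A = 0" using that by (intro det_zero_row[of _ r i]) auto
        with \<open>det ?A \<noteq> 0\<close> show False by simp
      qed
      then obtain t where t: "\<And>i. i < r \<Longrightarrow> t i < r \<and> sh \<alpha> i = sh \<beta> (t i)" by metis
      have "t i < t (Suc i)" if "Suc i < r" for i
        using sh_less[of i "Suc i" \<alpha>] t[of i] t[of "Suc i"] that sh_less[of "t (Suc i)" "t i" \<beta>]
        by (cases "t i" "t (Suc i)" rule: linorder_cases) auto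
      then have "t i = i" if "i < r" for i
        using strict_mono_on_eq_self[of r t i] t that by blast
      then have "lookup (transpose_part \<alpha>) i = lookup (transpose_part \<beta>) i" if "i < r" for i
        using t[OF that] that by (simp add: shifted_entry_def)
      then have "\<alpha> = \<beta>" using assms by (intro partition_eqI_transpose)
      with False show False by simp
    qed
    then show ?thesis using False sp by simp
  qed
qed

section \<open>The branching rule for alternants and Schur functions\<close>

lemma alternant_eq_det:
  "alternant n \<alpha> = det (mat n n (\<lambda>(i, j). poly_X j ^ lookup \<alpha> i))"
  unfolding alternant_def
  by (subst det_def'[of _ n])
    (auto intro!: sum.cong prod.cong simp: atLeast0LessThan permutes_in_image[of _ "{..<n}", simplified])

lemma det_mult_cols:
  fixes d :: "nat \<Rightarrow> 'a :: comm_ring_1"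
  shows "det (mat n n (\<lambda>(i, j). d j * A i j)) = (\<Prod>j<n. d j) * det (mat n n (\<lambda>(i, j). A i j))"
proof -
  have "det (mat n n (\<lambda>(i, j). d j * A i j)) =
      (\<Sum>p | p permutes {0..<n}. signof p * (\<Prod>i<n. d (p i) * A i (p i)))"
    by (subst det_def'[of _ n])
      (auto intro!: sum.cong prod.cong simp: atLeast0LessThan permutes_in_image[of _ "{..<n}", simplified])
  also have "\<dots> = (\<Sum>p | p permutes {0..<n}. (\<Prod>j<n. d j) * (signof p * (\<Prod>i<n. A i (p i))))"
  proof (rule sum.cong[OF refl])
    fix p assume "p \<in> {p. p permutes {0..<n}}"
    then have "(\<Prod>i<n. d (p i)) = (\<Prod>j<n. d j)"
      using prod.permute[of p "{..<n}" d] by (simp add: atLeast0LessThan o_def)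
    then show "signof p * (\<Prod>i<n. d (p i) * A i (p i)) = (\<Prod>j<n. d j) * (signof p * (\<Prod>i<n. A i (p i)))"
      by (simp add: prod.distrib algebra_simps)
  qed
  also have "\<dots> = (\<Prod>j<n. d j) * det (mat n n (\<lambda>(i, j). A i j))"
    by (subst det_def'[of _ n])
      (auto intro!: sum.cong prod.cong simp: sum_distrib_left atLeast0LessThan permutes_in_image[of _ "{..<n}", simplified])
  finally show ?thesis .
qed

text \<open>All subtractions use the original row below and happen at once, which is left
  multiplication by a unipotent upper triangular matrix.\<close>

lemma det_subtract_next_rows:
  fixes A :: "nat \<Rightarrow> nat \<Rightarrow> 'a :: idom"
  shows "det (mat n n (\<lambda>(i, j). if Suc i < n then A i j - c i * A (Suc i) j else A i j)) =
    det (mat n n (\<lambda>(i, j). A i j))"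
proof -
  define U where "U = mat n n (\<lambda>(i, k). if k = i then 1 else if k = Suc i then - c i else 0)"
  have "mat n n (\<lambda>(i, j). if Suc i < n then A i j - c i * A (Suc i) j else A i j) =
      U * mat n n (\<lambda>(i, j). A i j)"
  proof (rule eq_matI)
    fix i j assume "i < dim_row (U * mat n n (\<lambda>(i, j). A i j))" "j < dim_col (U * mat n n (\<lambda>(i, j). A i j))"
    then have ij: "i < n" "j < n" by (simp_all add: U_def)
    have "(U * mat n n (\<lambda>(i, j). A i j)) $$ (i, j) =
        (\<Sum>k = 0..<n. (if k = i then 1 else if k = Suc i then - c i else 0) * A k j)"
      using ij by (simp add: U_def scalar_prod_def)
    also have "\<dots> = (\<Sum>k\<in>{0..<n}. (if k = i then A i j else 0) + (if k = Suc i then - c i * A (Suc i) j else 0))"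
      by (rule sum.cong) auto
    also have "\<dots> = (if Suc i < n then A i j - c i * A (Suc i) j else A i j)"
      using ij by (simp add: sum.distrib)
    finally show "mat n n (\<lambda>(i, j). if Suc i < n then A i j - c i * A (Suc i) j else A i j) $$ (i, j) =
        (U * mat n n (\<lambda>(i, j). A i j)) $$ (i, j)"
      using ij by simp
  qed (simp_all add: U_def)
  moreover have "det U = 1"
  proof -
    have "det U = prod_list (diag_mat U)"
      by (rule det_upper_triangular) (auto simp: U_def)
    also have "diag_mat U = map (\<lambda>_. 1) [0..<n]"
      unfolding diag_mat_def by (auto simp: U_def)
    finally show ?thesis by (simp add: map_replicate_const)
  qed
  moreover have "det (U * mat n n (\<lambda>(i, j). A i j)) = det U * det (mat n n (\<lambda>(i, j). A i j))"
    by (rule det_mult) (auto simp: U_def)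
  ultimately show ?thesis by simp
qed

text \<open>A geometric sum, indexed so that the exponent m of x runs from b to a - 1; in the
  branching rule this interval becomes the interlacing condition.\<close>

lemma power_diff_factor:
  fixes x y :: "'a :: comm_ring_1"
  assumes "b \<le> a"
  shows "x ^ a - y ^ (a - b) * x ^ b = (x - y) * (\<Sum>m\<in>{b..<a}. y ^ (a - 1 - m) * x ^ m)"
  using assms
proof (induction rule: dec_induct)
  case (step a)
  have "(\<Sum>m\<in>{b..<Suc a}. y ^ (Suc a - 1 - m) * x ^ m) =
      y * (\<Sum>m\<in>{b..<a}. y ^ (a - 1 - m) * x ^ m) + x ^ a"
  proof -
    have "y ^ (a - m) * x ^ m = y * (y ^ (a - 1 - m) * x ^ m)" if "m < a" for m
    proof -
      have "a - m = Suc (a - 1 - m)" using that by simp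
      then show ?thesis by (simp add: mult.assoc)
    qed
    then show ?thesis
      using step.hyps by (simp add: sum_distrib_left)
  qed
  then have "(x - y) * (\<Sum>m\<in>{b..<Suc a}. y ^ (Suc a - 1 - m) * x ^ m) =
     y * (x ^ a - y ^ (a - b) * x ^ b) + (x - y) * x ^ a"
    unfolding step.IH by (simp add: algebra_simps)
  also have "\<dots> = x ^ Suc a - y ^ (Suc a - b) * x ^ b"
    using step.hyps by (simp add: algebra_simps Suc_diff_le)
  finally show ?case by simp
qed simp

lemma hstrips_in_vec_Suc:
  assumes "\<kappa> \<in> hstrips \<alpha>" "in_vec n \<kappa>"
  shows "in_vec (Suc n) \<alpha>"
proof -
  have "i < Suc n" if "i \<in> keys \<alpha>" for i
  proof (rule ccontr)
    assume i: "\<not> i < Suc n"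
    then obtain k where k: "i = Suc k" by (cases i) auto
    then have "0 < lookup \<kappa> k"
      using assms(1) that by (auto simp: hstrips_def in_keys_iff intro: less_le_trans)
    then show False using assms(2) i k by (auto simp: in_vec_def in_keys_iff subset_iff)
  qed
  then show ?thesis by (auto simp: in_vec_def)
qed

lemma mono_degree_in_vec: "in_vec n m \<Longrightarrow> mono_degree m = (\<Sum>i<n. lookup m i)"
  unfolding in_vec_def by (rule mono_degree_superset) auto

text \<open>Subtracting from each row the multiple of the next one that cancels its entry at the
  last variable isolates the last column. What remains expands over exponents lying between
  consecutive entries of \<delta> + \<alpha>.\<close>

lemma alternant_branching:
  assumes \<alpha>: "is_partition \<alpha>" "in_vec (Suc n) \<alpha>"
  shows "alternant (Suc n) (staircase (Suc n) + \<alpha>) =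
    (\<Prod>j<n. poly_X j - poly_X n) *
    (\<Sum>\<kappa> | \<kappa> \<in> hstrips \<alpha> \<and> in_vec n \<kappa>.
       poly_X n ^ (mono_degree \<alpha> - mono_degree \<kappa>) * alternant n (staircase n + \<kappa>))"
proof -
  define l where "l = lookup (staircase (Suc n) + \<alpha>)"
  have l: "l i = n - i + lookup \<alpha> i" if "i \<le> n" for i
    using that by (simp add: l_def lookup_add lookup_staircase)
  have l_dec: "l (Suc i) < l i" if "i < n" for i
    using that l[of i] l[of "Suc i"] partition_antimono[OF \<alpha>(1), of i "Suc i"] by simp
  define B where "B = mat (Suc n) (Suc n) (\<lambda>(i, j). if Suc i < Suc n
    then poly_X j ^ l i - poly_X n ^ (l i - l (Suc i)) * poly_X j ^ l (Suc i) else poly_X j ^ l i)"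
  let ?M = "\<lambda>i. {l (Suc i)..<l i}"
  have "alternant (Suc n) (staircase (Suc n) + \<alpha>) = det (mat (Suc n) (Suc n) (\<lambda>(i, j). poly_X j ^ l i))"
    by (simp add: alternant_eq_det l_def)
  \<comment> \<open>In \<open>B\<close> all entries of the last column but the bottom one vanish, and the other columns
    are divisible by \<open>X\<^sub>j - X\<^sub>n\<close>.\<close>
  also have "\<dots> = det B"
    unfolding B_def by (rule det_subtract_next_rows[symmetric])
  also have "\<dots> = (\<Sum>i<Suc n. B $$ (i, n) * cofactor B i n)"
    by (rule laplace_expansion_column) (auto simp: B_def)
  also have "\<dots> = poly_X n ^ l n * det (mat_delete B n n)"
  proof -
    have "B $$ (i, n) = 0" if "i < n" for i
      using that l_dec[OF that] by (simp add: B_def flip: power_add)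
    then show ?thesis by (simp add: cofactor_def B_def)
  qed
  also have "mat_delete B n n = mat n n (\<lambda>(i, j). (poly_X j - poly_X n) *
      (\<Sum>m\<in>?M i. poly_X n ^ (l i - 1 - m) * poly_X j ^ m))"
    by (rule eq_matI) (auto simp: mat_delete_def B_def power_diff_factor less_imp_le[OF l_dec])
  also have "det \<dots> = (\<Prod>j<n. poly_X j - poly_X n) *
      (\<Sum>f\<in>Pi\<^sub>E {..<n} ?M. (\<Prod>i<n. poly_X n ^ (l i - 1 - f i)) * det (mat n n (\<lambda>(i, j). poly_X j ^ f i)))"
    unfolding det_mult_cols by (subst det_sum_rows) simp_all
  also have "poly_X n ^ l n * \<dots> = (\<Prod>j<n. poly_X j - poly_X n) *
      (\<Sum>f\<in>Pi\<^sub>E {..<n} ?M. poly_X n ^ (l n + (\<Sum>i<n. l i - 1 - f i)) * det (mat n n (\<lambda>(i, j). poly_X j ^ f i)))"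
    by (simp add: sum_distrib_left power_add power_sum mult_ac)
  \<comment> \<open>Here l i = n - i + \<alpha>_i and f i = n - 1 - i + \<kappa>_i, so l (i + 1)
    \<le> f i < l i says that \<alpha>_(i+1) \<le> \<kappa>_i \<le> \<alpha>_i; the term l n =
    \<alpha>_n completes the exponent to |\<alpha>| - |\<kappa>|.\<close>
  also have "(\<Sum>f\<in>Pi\<^sub>E {..<n} ?M. poly_X n ^ (l n + (\<Sum>i<n. l i - 1 - f i)) * det (mat n n (\<lambda>(i, j). poly_X j ^ f i))) =
      (\<Sum>\<kappa> | \<kappa> \<in> hstrips \<alpha> \<and> in_vec n \<kappa>.
       poly_X n ^ (mono_degree \<alpha> - mono_degree \<kappa>) * alternant n (staircase n + \<kappa>))"
  proof (rule sum.reindex_bij_witness[symmetric, where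
        i = "\<lambda>f. vec_of n (\<lambda>i. f i - (n - 1 - i))" and
        j = "\<lambda>\<kappa>. restrict (lookup (staircase n + \<kappa>)) {..<n}"])
    fix \<kappa> assume "\<kappa> \<in> {\<kappa>. \<kappa> \<in> hstrips \<alpha> \<and> in_vec n \<kappa>}"
    then have \<kappa>: "is_partition \<kappa>" "in_vec n \<kappa>"
        "\<And>i. lookup \<kappa> i \<le> lookup \<alpha> i" "\<And>i. lookup \<alpha> (Suc i) \<le> lookup \<kappa> i"
      by (auto simp: hstrips_def)
    let ?f = "restrict (lookup (staircase n + \<kappa>)) {..<n}"
    have f: "?f i = n - 1 - i + lookup \<kappa> i" if "i < n" for i
      using that by (simp add: lookup_add lookup_staircase)
    show "vec_of n (\<lambda>i. ?f i - (n - 1 - i)) = \<kappa>"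
      using \<kappa>(2) by (intro poly_mapping_eqI)
        (auto simp: lookup_vec_of lookup_add lookup_staircase in_vec_def in_keys_iff subset_iff)
    show "?f \<in> Pi\<^sub>E {..<n} ?M"
    proof (rule PiE_I)
      fix i assume "i \<in> {..<n}"
      then show "?f i \<in> ?M i"
        using f[of i] l[of i] l[of "Suc i"] \<kappa>(3)[of i] \<kappa>(4)[of i] by auto
    qed simp
    have "l n + (\<Sum>i<n. l i - 1 - ?f i) = mono_degree \<alpha> - mono_degree \<kappa>"
    proof -
      have "l i - 1 - ?f i = lookup \<alpha> i - lookup \<kappa> i" if "i < n" for i
        using that f[OF that] l[of i] by simp
      then have "(\<Sum>i<n. l i - 1 - ?f i) = (\<Sum>i<n. lookup \<alpha> i) - (\<Sum>i<n. lookup \<kappa> i)"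
        using \<kappa>(3) by (subst sum_subtractf_nat[symmetric]) auto
      moreover have "(\<Sum>i<n. lookup \<kappa> i) \<le> (\<Sum>i<n. lookup \<alpha> i)"
        by (rule sum_mono) (rule \<kappa>(3))
      ultimately show ?thesis
        using mono_degree_in_vec[OF \<alpha>(2)] mono_degree_in_vec[OF \<kappa>(2)] l[of n] by simp
    qed
    moreover have "mat n n (\<lambda>(i, j). poly_X j ^ ?f i) = mat n n (\<lambda>(i, j). poly_X j ^ lookup (staircase n + \<kappa>) i)"
      by (rule eq_matI) auto
    ultimately show "poly_X n ^ (l n + (\<Sum>i<n. l i - 1 - ?f i)) * det (mat n n (\<lambda>(i, j). poly_X j ^ ?f i)) =
        poly_X n ^ (mono_degree \<alpha> - mono_degree \<kappa>) * alternant n (staircase n + \<kappa>)"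
      unfolding alternant_eq_det by metis
  next
    fix f assume f: "f \<in> Pi\<^sub>E {..<n} ?M"
    let ?\<kappa> = "vec_of n (\<lambda>i. f i - (n - 1 - i))"
    have fi: "l (Suc i) \<le> f i" "f i < l i" if "i < n" for i
      using PiE_mem[OF f, of i] that by auto
    have fi': "f i = n - 1 - i + lookup ?\<kappa> i" if "i < n" for i
      using fi[OF that] l[of "Suc i"] that by (simp add: lookup_vec_of)
    have out: "lookup \<alpha> (Suc i) = 0" if "\<not> i < n" for i
      using \<alpha>(2) that by (auto simp: in_vec_def in_keys_iff subset_iff)
    have bounds: "lookup ?\<kappa> i \<le> lookup \<alpha> i" "lookup \<alpha> (Suc i) \<le> lookup ?\<kappa> i" for i
    proof -
      have "lookup ?\<kappa> i \<le> lookup \<alpha> i \<and> lookup \<alpha> (Suc i) \<le> lookup ?\<kappa> i"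
      proof (cases "i < n")
        case True
        then show ?thesis using fi[OF True] fi'[OF True] l[of i] l[of "Suc i"] by linarith
      next
        case False
        then show ?thesis using out by (simp add: lookup_vec_of)
      qed
      then show "lookup ?\<kappa> i \<le> lookup \<alpha> i" "lookup \<alpha> (Suc i) \<le> lookup ?\<kappa> i" by simp_all
    qed
    then have "is_partition ?\<kappa>"
      unfolding is_partition_def by (meson order_trans)
    with bounds show "?\<kappa> \<in> {\<kappa>. \<kappa> \<in> hstrips \<alpha> \<and> in_vec n \<kappa>}"
      by (simp add: hstrips_def in_vec_vec_of)
    show "restrict (lookup (staircase n + ?\<kappa>)) {..<n} = f"
    proof
      fix i show "restrict (lookup (staircase n + ?\<kappa>)) {..<n} i = f i"
        using fi'[of i] PiE_arb[OF f, of i] by (cases "i < n") (simp_all add: lookup_add lookup_staircase)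
    qed
  qed
  finally show ?thesis .
qed

section \<open>Schur functions as determinants with empty inner shape\<close>

lemma is_partition_0: "is_partition 0"
  by (simp add: is_partition_def)

lemma hstrips_0: "hstrips 0 = {0}"
  by (auto simp: hstrips_def is_partition_def intro!: poly_mapping_eqI)

lemma in_vec_0: "in_vec n 0"
  by (simp add: in_vec_def)

lemma sh_ge: "j < r \<Longrightarrow> - int r \<le> sh \<alpha> j"
  by (simp add: shifted_entry_def)

text \<open>Multiplying by a_\<delta> replaces division. The vanishing for too many rows belongs to
  the same induction: it discards the inner shapes with more than n rows and leaves the index set of
  the branching rule for alternants.\<close>

lemma specialise_edet_alternant:
  assumes "is_partition \<alpha>" "lookup \<alpha> 0 \<le> r"
  shows "(in_vec n \<alpha> \<longrightarrow> specialise n (edet r (sh \<alpha>) (sh 0)) * alternant n (staircase n) =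
      alternant n (staircase n + \<alpha>)) \<and>
    (\<not> in_vec n \<alpha> \<longrightarrow> specialise n (edet r (sh \<alpha>) (sh 0)) = 0)"
  using assms
proof (induction n arbitrary: \<alpha>)
  case 0
  have "in_vec 0 \<alpha> \<longleftrightarrow> \<alpha> = 0" by (auto simp: in_vec_def)
  then show ?case
    using specialise_0_edet_sh[OF 0(1) is_partition_0 0(2)] by (cases "\<alpha> = 0") (simp_all add: alternant_def)
next
  case (Suc n)
  let ?P = "\<lambda>n \<alpha>. specialise n (edet r (sh \<alpha>) (sh 0))"
  have H: "is_partition \<kappa>" "lookup \<kappa> 0 \<le> r" if "\<kappa> \<in> hstrips \<alpha>" for \<kappa>
    using that Suc.prems by (auto simp: hstrips_def intro: order_trans)
  have rec: "?P (Suc n) \<alpha> = (\<Sum>\<kappa>\<in>hstrips \<alpha>. poly_X n ^ (mono_degree \<alpha> - mono_degree \<kappa>) * ?P n \<kappa>)"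
    by (rule specialise_Suc_edet_sh[OF Suc.prems sh_ge])
  show ?case
  proof (intro conjI impI)
    assume \<alpha>: "in_vec (Suc n) \<alpha>"
    let ?Q = "\<Prod>j<n. poly_X j - poly_X n"
    \<comment> \<open>The recursion of the Vandermonde determinant is the branching rule for the
      empty shape.\<close>
    have st: "alternant (Suc n) (staircase (Suc n)) = ?Q * alternant n (staircase n)"
    proof -
      have "{\<kappa>. \<kappa> \<in> hstrips 0 \<and> in_vec n \<kappa>} = {0}" by (auto simp: hstrips_0 in_vec_0)
      then show ?thesis
        using alternant_branching[OF is_partition_0 in_vec_0, of n] by simp
    qed
    have "?P (Suc n) \<alpha> = (\<Sum>\<kappa> | \<kappa> \<in> hstrips \<alpha> \<and> in_vec n \<kappa>. poly_X n ^ (mono_degree \<alpha> - mono_degree \<kappa>) * ?P n \<kappa>)"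
      unfolding rec using Suc.IH H by (intro sum.mono_neutral_right) (auto simp: finite_hstrips)
    then have "?P (Suc n) \<alpha> * alternant (Suc n) (staircase (Suc n)) = ?Q *
        (\<Sum>\<kappa> | \<kappa> \<in> hstrips \<alpha> \<and> in_vec n \<kappa>. poly_X n ^ (mono_degree \<alpha> - mono_degree \<kappa>) * (?P n \<kappa> * alternant n (staircase n)))"
      unfolding st by (simp add: sum_distrib_left sum_distrib_right mult_ac)
    also have "\<dots> = alternant (Suc n) (staircase (Suc n) + \<alpha>)"
      unfolding alternant_branching[OF Suc.prems(1) \<alpha>]
      using Suc.IH H by (intro arg_cong2[of _ _ _ _ "(*)"] sum.cong) auto
    finally show "?P (Suc n) \<alpha> * alternant (Suc n) (staircase (Suc n)) = alternant (Suc n) (staircase (Suc n) + \<alpha>)" .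
  next
    assume "\<not> in_vec (Suc n) \<alpha>"
    then have "\<not> in_vec n \<kappa>" if "\<kappa> \<in> hstrips \<alpha>" for \<kappa>
      using hstrips_in_vec_Suc that by blast
    then show "?P (Suc n) \<alpha> = 0"
      unfolding rec using Suc.IH H by (intro sum.neutral) auto
  qed
qed

lemma alternant_staircase_nonzero: "alternant n (staircase n) \<noteq> 0"
proof
  assume "alternant n (staircase n) = 0"
  then show False
    using lookup_alternant_strict[OF is_partition_0 is_partition_0 in_vec_0 in_vec_0, of n] by simp
qed

text \<open>The determinant provides the symmetric function whose existence the definition of
  \<open>schur\<close> requires; cancelling the nonzero Vandermonde determinant makes each quotient
  unique.\<close>

lemma schur_eq_edet:
  assumes "is_partition \<alpha>" "lookup \<alpha> 0 \<le> r"
  shows "schur \<alpha> = edet r (sh \<alpha>) (sh 0)"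
proof -
  have "schur_poly n \<alpha> = specialise n (edet r (sh \<alpha>) (sh 0))" for n
  proof (cases "in_vec n \<alpha>")
    case True
    then have "specialise n (edet r (sh \<alpha>) (sh 0)) * alternant n (staircase n) = alternant n (staircase n + \<alpha>)"
      using specialise_edet_alternant[OF assms, of n] by blast
    then show ?thesis
      unfolding schur_poly_def using True
      by (simp add: alternant_staircase_nonzero flip: \<open>_ = alternant n _\<close>)
  next
    case False
    then show ?thesis
      unfolding schur_poly_def using specialise_edet_alternant[OF assms, of n] by simp
  qed
  then show ?thesis
    unfolding schur_def by (intro the_equality specialise_inject) simp_all
qed

lemma specialise_schur:
  assumes "is_partition \<alpha>"
  shows "alternant n (staircase n) * specialise n (schur \<alpha>) =
    (if in_vec n \<alpha> then alternant n (staircase n + \<alpha>) else 0)"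
  using specialise_edet_alternant[OF assms order_refl, of n] schur_eq_edet[OF assms order_refl]
  by (simp add: mult.commute)

section \<open>Schur coordinates and the scalar product\<close>

text \<open>For a partition \<open>\<alpha>\<close> with at most \<open>n\<close> parts this is the coefficient of \<open>s\<^sub>\<alpha>\<close> in \<open>f\<close>, because
  \<open>a\<^sub>\<delta> s\<^sub>\<alpha> = a\<^sub>\<delta>\<^sub>+\<^sub>\<alpha>\<close>; in particular it does not depend on \<open>n\<close>.\<close>

definition schur_coord :: "nat \<Rightarrow> composition \<Rightarrow> symfun \<Rightarrow> int" where
  "schur_coord n \<alpha> f = lookup (alternant n (staircase n) * specialise n f) (staircase n + \<alpha>)"

lemma specialise_of_int_mult: "specialise n (of_int z * f) = of_int z * specialise n f"
  by (rule poly_mapping_eqI) (simp add: lookup_of_int_mult lookup_specialise coef_of_int_mult)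

lemma schur_coord_add: "schur_coord n \<alpha> (f + g) = schur_coord n \<alpha> f + schur_coord n \<alpha> g"
  by (simp add: schur_coord_def specialise_add distrib_left lookup_add)

lemma schur_coord_0: "schur_coord n \<alpha> 0 = 0"
  by (simp add: schur_coord_def specialise_0)

lemma schur_coord_sum: "schur_coord n \<alpha> (\<Sum>x\<in>A. f x) = (\<Sum>x\<in>A. schur_coord n \<alpha> (f x))"
  by (induction A rule: infinite_finite_induct) (simp_all add: schur_coord_add schur_coord_0)

lemma schur_coord_of_int_mult: "schur_coord n \<alpha> (of_int z * f) = z * schur_coord n \<alpha> f"
  by (simp add: schur_coord_def specialise_of_int_mult mult.left_commute[of _ "of_int z"] lookup_of_int_mult)

lemma schur_coord_diff: "schur_coord n \<alpha> (f - g) = schur_coord n \<alpha> f - schur_coord n \<alpha> g"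
  using schur_coord_add[of n \<alpha> "f - g" g] by simp

lemma schur_coord_schur:
  assumes "is_partition \<alpha>" "is_partition \<beta>" "in_vec n \<alpha>"
  shows "schur_coord n \<alpha> (schur \<beta>) = (if \<alpha> = \<beta> then 1 else 0)"
  using assms lookup_alternant_strict[OF assms(2,1) _ assms(3)]
  by (auto simp: schur_coord_def specialise_schur)

text \<open>Integer degrees let \<open>elementary d\<close> with d < 0, which is zero, count as
  homogeneous of degree d, so that degrees add up uniformly in a determinant.\<close>

definition homogeneous :: "int \<Rightarrow> symfun \<Rightarrow> bool" where
  "homogeneous d f \<longleftrightarrow> (\<forall>m. coef f m \<noteq> 0 \<longrightarrow> int (mono_degree m) = d)"

lemma homogeneous_mult:
  assumes "homogeneous c f" "homogeneous d g"
  shows "homogeneous (c + d) (f * g)"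
  unfolding homogeneous_def
proof (intro allI impI)
  fix m assume "coef (f * g) m \<noteq> 0"
  then obtain x where "x \<in> splittings m" "(case x of (a, b) \<Rightarrow> coef f a * coef g b) \<noteq> 0"
    unfolding coef_mult by (meson sum.neutral)
  then show "int (mono_degree m) = c + d"
    using assms by (auto simp: homogeneous_def splittings_def mono_degree_add)
qed

lemma homogeneous_1: "homogeneous 0 1"
  by (simp add: homogeneous_def coef_1 mono_degree_def)

lemma homogeneous_prod:
  assumes "\<And>x. x \<in> A \<Longrightarrow> homogeneous (d x) (f x)"
  shows "homogeneous (sum d A) (prod f A)"
  using assms by (induction A rule: infinite_finite_induct) (simp_all add: homogeneous_1 homogeneous_mult)

lemma homogeneous_sum:
  assumes "\<And>x. x \<in> A \<Longrightarrow> homogeneous d (f x)"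
  shows "homogeneous d (sum f A)"
  unfolding homogeneous_def coef_sum
proof (intro allI impI)
  fix m assume "(\<Sum>x\<in>A. coef (f x) m) \<noteq> 0"
  then obtain x where "x \<in> A" "coef (f x) m \<noteq> 0" by (meson sum.neutral)
  then show "int (mono_degree m) = d" using assms by (auto simp: homogeneous_def)
qed

lemma homogeneous_of_int_mult: "homogeneous d f \<Longrightarrow> homogeneous d (of_int z * f)"
  by (auto simp: homogeneous_def coef_of_int_mult)

lemma homogeneous_elementary: "homogeneous d (elementary d)"
  by (simp add: homogeneous_def coef_elementary)

text \<open>The terms of the Leibniz expansion only permute the column shifts, so all of them have
  the same degree.\<close>

lemma homogeneous_edet: "homogeneous ((\<Sum>i<r. a i) - (\<Sum>i<r. b i)) (edet r a b)"
proof -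
  have "edet r a b = (\<Sum>p | p permutes {..<r}. signof p * (\<Prod>i<r. elementary (a i - b (p i))))"
    unfolding edet_def
    by (subst det_def'[of _ r])
      (auto intro!: sum.cong prod.cong simp: atLeast0LessThan permutes_in_image[of _ "{..<r}", simplified])
  moreover have "homogeneous ((\<Sum>i<r. a i) - (\<Sum>i<r. b i)) (signof p * (\<Prod>i<r. elementary (a i - b (p i))))"
    if p: "p permutes {..<r}" for p
  proof -
    have "(\<Sum>i<r. a i) - (\<Sum>i<r. b i) = (\<Sum>i<r. a i - b (p i))"
      using sum.permute[OF p, of b] by (simp add: sum_subtractf o_def)
    then show ?thesis
      by (auto intro!: homogeneous_of_int_mult homogeneous_prod homogeneous_elementary)
  qed
  ultimately show ?thesis by (auto intro!: homogeneous_sum)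
qed

lemma transpose_part_0: "lookup (transpose_part 0) j = 0"
  by (simp add: lookup_transpose)

lemma homogeneous_schur:
  assumes "is_partition \<alpha>"
  shows "homogeneous (int (mono_degree \<alpha>)) (schur \<alpha>)"
proof -
  let ?r = "lookup \<alpha> 0"
  have "(\<Sum>i<?r. sh \<alpha> i) - (\<Sum>i<?r. sh 0 i) = int (\<Sum>i<?r. lookup (transpose_part \<alpha>) i)"
    by (simp add: shifted_entry_def transpose_part_0 flip: sum_subtractf)
  also have "\<dots> = int (mono_degree \<alpha>)"
    by (simp only: mono_degree_transpose[OF assms order_refl])
  finally show ?thesis
    using homogeneous_edet[where r = ?r and a = "sh \<alpha>" and b = "sh 0"] schur_eq_edet[OF assms order_refl] by simp
qed

lemma mono_degree_map_key:
  assumes "bij \<sigma>"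
  shows "mono_degree (map_key \<sigma> m) = mono_degree m"
proof -
  have "bij_betw \<sigma> (keys (map_key \<sigma> m)) (keys m)"
    unfolding keys_map_key[OF bij_is_inj[OF assms]]
    using assms by (auto simp: bij_betw_def surj_image_vimage_eq intro: inj_on_subset)
  then show ?thesis
    unfolding mono_degree_def lookup_map_key_bij[OF assms]
    by (rule sum.reindex_bij_betw)
qed

text \<open>All monomials of a_\<delta> have the degree of \<delta>, so the coefficient at \<delta>
  + \<alpha> sees only the part of f of degree |\<alpha>|.\<close>

lemma schur_coord_nonzero:
  assumes "schur_coord n \<alpha> f \<noteq> 0"
  obtains m where "coef f m \<noteq> 0" "mono_degree m = mono_degree \<alpha>"
proof -
  obtain x where x: "x \<in> splittings (staircase n + \<alpha>)"
    "(case x of (a, b) \<Rightarrow> lookup (alternant n (staircase n)) a * lookup (specialise n f) b) \<noteq> 0"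
    using assms unfolding schur_coord_def lookup_times by (meson sum.neutral)
  obtain a b where ab: "x = (a, b)" by (cases x)
  have "lookup (alternant n (staircase n)) a \<noteq> 0" and b: "coef f b \<noteq> 0"
    using x ab by (auto simp: lookup_specialise split: if_splits)
  then obtain \<sigma> where "\<sigma> permutes {..<n}" "map_key \<sigma> a = staircase n"
    unfolding lookup_alternant[OF in_vec_staircase] by (force elim: sum.not_neutral_contains_not_neutral split: if_splits)
  then have "mono_degree a = mono_degree (staircase n)"
    using mono_degree_map_key[OF permutes_bij, of \<sigma> _ a] by simp
  moreover have "mono_degree (a + b) = mono_degree (staircase n + \<alpha>)"
    using x ab by (simp add: splittings_def)
  ultimately have "mono_degree b = mono_degree \<alpha>"
    by (simp add: mono_degree_add)
  with b show ?thesis by (rule that)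
qed

text \<open>Serves to rename the variables of a monomial into the first d ones. An initial segment
  goes onto K, and the complements of both within their union, being of equal size, are matched
  arbitrarily.\<close>

lemma ex_bij_vimage_subset_lessThan:
  fixes K :: "nat set"
  assumes K: "finite K" "card K \<le> d"
  shows "\<exists>\<sigma>. bij \<sigma> \<and> \<sigma> -` K \<subseteq> {..<d}"
proof -
  let ?C = "{..<card K}"
  let ?A = "K \<union> ?C"
  obtain f where f: "bij_betw f ?C K"
    using ex_bij_betw_nat_finite[OF K(1)] by (auto simp: atLeast0LessThan)
  have "card (?A - ?C) = card (?A - K)"
    using K by (simp add: card_Diff_subset)
  then obtain g where g: "bij_betw g (?A - ?C) (?A - K)"
    using finite_same_card_bij[of "?A - ?C" "?A - K"] K by auto
  let ?h = "\<lambda>x. if x \<in> ?C then f x else g x"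
  have h: "bij_betw ?h (?C \<union> (?A - ?C)) (K \<union> (?A - K))"
    by (rule bij_betw_disjoint_Un[OF f g]) auto
  define \<sigma> where "\<sigma> x = (if x \<in> ?A then ?h x else x)" for x
  have "bij_betw \<sigma> ?A ?A"
    using h by (subst bij_betw_cong[of _ _ ?h]) (auto simp: \<sigma>_def Un_absorb1 Un_commute sup.absorb1)
  then have p: "\<sigma> permutes ?A"
    by (rule bij_imp_permutes) (simp add: \<sigma>_def)
  have "x \<in> ?C" if "\<sigma> x \<in> K" for x
  proof (rule ccontr)
    assume x: "x \<notin> ?C"
    have "x \<in> ?A" using permutes_in_image[OF p, of x] that by blast
    then have "\<sigma> x = g x" "g x \<in> ?A - K"
      using x bij_betwE[OF g] by (auto simp: \<sigma>_def)
    with that show False by auto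
  qed
  then show ?thesis
    using permutes_bij[OF p] K(2) by (intro exI[of _ \<sigma>]) fastforce
qed

lemma card_keys_le: "card (keys (m :: monomial)) \<le> mono_degree m"
proof -
  have "card (keys m) = (\<Sum>i\<in>keys m. 1)" by simp
  also have "\<dots> \<le> mono_degree m"
    unfolding mono_degree_def by (rule sum_mono) (simp add: in_keys_iff Suc_le_eq)
  finally show ?thesis .
qed

text \<open>A monomial of degree at most d involves at most d variables, and symmetry moves it into
  the first d, where the specialisation sees it.\<close>

lemma symfun_eq_0I:
  assumes d: "\<And>m. coef f m \<noteq> 0 \<Longrightarrow> mono_degree m \<le> d" and z: "specialise d f = 0"
  shows "f = 0"
proof (rule symfun_eqI)
  fix m
  have "coef f m = 0"
  proof (rule ccontr)
    assume nz: "coef f m \<noteq> 0"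
    then have "card (keys m) \<le> d" using d card_keys_le order_trans by blast
    then obtain \<sigma> where \<sigma>: "bij \<sigma>" "\<sigma> -` keys m \<subseteq> {..<d}"
      using ex_bij_vimage_subset_lessThan[of "keys m" d] by auto
    have "keys (map_key \<sigma> m) \<subseteq> {..<d}"
      unfolding keys_map_key[OF bij_is_inj[OF \<sigma>(1)]] by (rule \<sigma>(2))
    then have "coef f (map_key \<sigma> m) = 0"
      using lookup_specialise[of d f "map_key \<sigma> m"] z by simp
    with nz \<sigma>(1) show False by (simp add: coef_map_key)
  qed
  then show "coef f m = coef 0 m" by (simp add: coef_0)
qed

section \<open>Expansion in Schur functions\<close>

lemma partition_in_vec:
  assumes "is_partition \<alpha>"
  shows "in_vec (mono_degree \<alpha>) \<alpha>"
proof -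
  have "i < mono_degree \<alpha>" if i: "i \<in> keys \<alpha>" for i
  proof -
    have "j \<in> keys \<alpha>" if "j \<le> i" for j
      using i partition_antimono[OF assms that] by (simp add: in_keys_iff)
    then have "{..i} \<subseteq> keys \<alpha>" by auto
    then have "card {..i} \<le> card (keys \<alpha>)" by (intro card_mono) auto
    with card_keys_le[of \<alpha>] show ?thesis by simp
  qed
  then show ?thesis by (auto simp: in_vec_def)
qed

definition partitions_upto :: "nat \<Rightarrow> composition set" where
  "partitions_upto d = {\<nu>. is_partition \<nu> \<and> mono_degree \<nu> \<le> d}"

lemma in_vec_mono: "in_vec n \<alpha> \<Longrightarrow> n \<le> k \<Longrightarrow> in_vec k \<alpha>"
  by (auto simp: in_vec_def)

lemma finite_partitions_upto: "finite (partitions_upto d)"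
proof (rule finite_subset)
  show "partitions_upto d \<subseteq> {m. keys m \<subseteq> {..<d} \<and> (\<forall>i. lookup m i \<le> d)}"
    using in_vec_mono[OF partition_in_vec]
    by (auto simp: partitions_upto_def in_vec_def intro: order_trans[OF lookup_le_mono_degree])
qed (simp add: finite_bounded_monomials)

text \<open>The bound d serves both as degree and as number of variables. Multiplied by a_\<delta>,
  the difference of both sides has coefficient zero at every \<delta> + \<alpha>: by
  \<open>schur_coord_schur\<close> for |\<alpha>| \<le> d, and by degree beyond.\<close>

lemma schur_expansion:
  assumes d: "\<And>m. coef f m \<noteq> 0 \<Longrightarrow> mono_degree m \<le> d"
  shows "f = (\<Sum>\<nu>\<in>partitions_upto d. of_int (schur_coord d \<nu> f) * schur \<nu>)"
proof -
  define S where "S = (\<Sum>\<nu>\<in>partitions_upto d. of_int (schur_coord d \<nu> f) * schur \<nu>)"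
  have deg: "mono_degree m \<le> d" if "coef (f - S) m \<noteq> 0" for m
  proof (rule ccontr)
    assume m: "\<not> mono_degree m \<le> d"
    have "coef (schur \<nu>) m = 0" if "\<nu> \<in> partitions_upto d" for \<nu>
      using that m homogeneous_schur[of \<nu>] by (auto simp: partitions_upto_def homogeneous_def)
    then have "coef S m = 0" by (simp add: S_def coef_sum coef_of_int_mult)
    moreover have "coef f m = 0" using d m by blast
    ultimately show False using that by (simp add: coef_diff)
  qed
  have "schur_coord d \<alpha> (f - S) = 0" if \<alpha>: "is_partition \<alpha>" "in_vec d \<alpha>" for \<alpha>
  proof (cases "\<alpha> \<in> partitions_upto d")
    case True
    have "schur_coord d \<alpha> S = (\<Sum>\<nu>\<in>partitions_upto d. if \<alpha> = \<nu> then schur_coord d \<nu> f else 0)"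
      unfolding S_def schur_coord_sum schur_coord_of_int_mult
      by (rule sum.cong) (auto simp: schur_coord_schur \<alpha> partitions_upto_def)
    also have "\<dots> = schur_coord d \<alpha> f"
      using True by (simp add: finite_partitions_upto)
    finally show ?thesis by (simp add: schur_coord_diff)
  next
    case False
    show ?thesis
    proof (rule ccontr)
      assume "schur_coord d \<alpha> (f - S) \<noteq> 0"
      then obtain m where "coef (f - S) m \<noteq> 0" "mono_degree m = mono_degree \<alpha>"
        by (rule schur_coord_nonzero)
      with deg[of m] False \<alpha> show False by (auto simp: partitions_upto_def)
    qed
  qed
  then have "alternant d (staircase d) * specialise d (f - S) = 0"
    using alternating_times_specialise[OF alternating_alternant[OF in_vec_staircase]]
    by (intro alternating_eq_0) (simp_all add: schur_coord_def)
  then have "specialise d (f - S) = 0"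
    using alternant_staircase_nonzero[of d] by simp
  then have "f - S = 0" by (rule symfun_eq_0I[rotated]) (rule deg)
  then show ?thesis by (simp add: S_def)
qed

lemma symfun_bounded: "\<exists>d. \<forall>m. coef f m \<noteq> 0 \<longrightarrow> mono_degree m \<le> d"
  using ps_of_symfun[of f] by (auto simp: bounded_degree_ps_def)

text \<open>A partition has no more rows than boxes, so |\<alpha>| variables are enough to
  accommodate it.\<close>

definition schur_coeff :: "composition \<Rightarrow> symfun \<Rightarrow> int" where
  "schur_coeff \<alpha> = schur_coord (mono_degree \<alpha>) \<alpha>"

text \<open>Expand f into Schur functions: their coordinates at \<alpha> are Kronecker deltas in any
  number of variables that accommodates \<alpha>.\<close>

lemma schur_coord_eq_schur_coeff:
  assumes "is_partition \<alpha>" "in_vec n \<alpha>"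
  shows "schur_coord n \<alpha> f = schur_coeff \<alpha> f"
proof -
  obtain d where d: "\<And>m. coef f m \<noteq> 0 \<Longrightarrow> mono_degree m \<le> d"
    using symfun_bounded[of f] by blast
  have "schur_coord k \<alpha> f = (\<Sum>\<nu>\<in>partitions_upto d. if \<alpha> = \<nu> then schur_coord d \<nu> f else 0)"
    if "in_vec k \<alpha>" for k
    by (subst schur_expansion[of f d, OF d], assumption, unfold schur_coord_sum schur_coord_of_int_mult, rule sum.cong)
      (auto simp: schur_coord_schur that assms partitions_upto_def)
  from this[OF assms(2)] this[OF partition_in_vec[OF assms(1)]] show ?thesis
    by (simp add: schur_coeff_def)
qed

lemma schur_coeff_expansion:
  assumes d: "\<And>m. coef f m \<noteq> 0 \<Longrightarrow> mono_degree m \<le> d"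
  shows "f = (\<Sum>\<nu>\<in>partitions_upto d. of_int (schur_coeff \<nu> f) * schur \<nu>)"
proof -
  have "schur_coord d \<nu> f = schur_coeff \<nu> f" if "\<nu> \<in> partitions_upto d" for \<nu>
    using that by (auto simp: partitions_upto_def intro: schur_coord_eq_schur_coeff in_vec_mono[OF partition_in_vec])
  then show ?thesis using schur_expansion[of f d, OF d] by simp
qed

lemma schur_coeff_schur:
  "is_partition \<alpha> \<Longrightarrow> is_partition \<beta> \<Longrightarrow> schur_coeff \<alpha> (schur \<beta>) = (if \<alpha> = \<beta> then 1 else 0)"
  by (simp add: schur_coeff_def schur_coord_schur partition_in_vec)

lemmas schur_coeff_linear =
  schur_coord_add[of "mono_degree \<alpha>" \<alpha> for \<alpha>, folded schur_coeff_def]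
  schur_coord_sum[of "mono_degree \<alpha>" \<alpha> for \<alpha>, folded schur_coeff_def]
  schur_coord_of_int_mult[of "mono_degree \<alpha>" \<alpha> for \<alpha>, folded schur_coeff_def]

lemma schur_coeff_nonzero:
  assumes "schur_coeff \<alpha> f \<noteq> 0"
  obtains m where "coef f m \<noteq> 0" "mono_degree m = mono_degree \<alpha>"
  using assms unfolding schur_coeff_def by (rule schur_coord_nonzero)

section \<open>The scalar product in Schur coordinates\<close>

definition schur_support :: "symfun \<Rightarrow> composition set" where
  "schur_support f = {\<alpha>. is_partition \<alpha> \<and> schur_coeff \<alpha> f \<noteq> 0}"

lemma finite_schur_support: "finite (schur_support f)"
proof -
  obtain d where d: "\<And>m. coef f m \<noteq> 0 \<Longrightarrow> mono_degree m \<le> d"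
    using symfun_bounded[of f] by blast
  have "schur_support f \<subseteq> partitions_upto d"
    using d by (auto simp: schur_support_def partitions_upto_def elim!: schur_coeff_nonzero) metis
  then show ?thesis using finite_partitions_upto finite_subset by blast
qed

definition schur_form :: "symfun \<Rightarrow> symfun \<Rightarrow> int" where
  "schur_form f g = (\<Sum>\<alpha>\<in>schur_support f. schur_coeff \<alpha> f * schur_coeff \<alpha> g)"

text \<open>The defining sum depends on the support of the first argument; a common finite index set
  for several arguments turns symmetry and additivity into termwise statements.\<close>

lemma schur_form_superset:
  assumes "finite A" "schur_support f \<subseteq> A" "\<And>\<alpha>. \<alpha> \<in> A \<Longrightarrow> is_partition \<alpha>"
  shows "schur_form f g = (\<Sum>\<alpha>\<in>A. schur_coeff \<alpha> f * schur_coeff \<alpha> g)"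
  unfolding schur_form_def using assms
  by (intro sum.mono_neutral_left) (auto simp: schur_support_def)

lemma symmetric_bilinear_schur_form: "symmetric_bilinear schur_form"
  unfolding symmetric_bilinear_def
proof (intro conjI allI)
  fix f g h
  let ?A = "schur_support f \<union> schur_support g \<union> schur_support (f + g)"
  have A: "schur_form x y = (\<Sum>\<alpha>\<in>?A. schur_coeff \<alpha> x * schur_coeff \<alpha> y)"
    if "x \<in> {f, g, f + g}" for x y
    using that by (intro schur_form_superset) (auto simp: finite_schur_support, auto simp: schur_support_def)
  show "schur_form f g = schur_form g f"
    by (simp add: A mult.commute)
  show "schur_form (f + g) h = schur_form f h + schur_form g h"
    by (simp add: A schur_coeff_linear algebra_simps sum.distrib)
qed

lemma schur_form_schur:
  assumes "is_partition \<alpha>"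
  shows "schur_form (schur \<alpha>) f = schur_coeff \<alpha> f"
proof -
  have "schur_form (schur \<alpha>) f = (\<Sum>\<beta>\<in>{\<alpha>}. schur_coeff \<beta> (schur \<alpha>) * schur_coeff \<beta> f)"
    using assms by (intro schur_form_superset) (auto simp: schur_support_def schur_coeff_schur split: if_splits)
  then show ?thesis using assms by (simp add: schur_coeff_schur)
qed

lemma symmetric_bilinear_lincomb:
  assumes B: "symmetric_bilinear B"
  shows "B (\<Sum>x\<in>A. of_int (z x) * s x) g = (\<Sum>x\<in>A. z x * B (s x) g)"
proof -
  have add: "B (f + f') g = B f g + B f' g" for f f'
    using B unfolding symmetric_bilinear_def by blast
  have 0: "B 0 g = 0" using add[of 0 0] by simp
  have neg: "B (- f) g = - B f g" for f using add[of f "- f"] 0 by simp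
  have nat: "B (of_nat k * f) g = int k * B f g" for k f
    by (induction k) (simp_all add: 0 add algebra_simps)
  have int: "B (of_int k * f) g = k * B f g" for k f
    by (cases k rule: int_cases2) (simp_all add: nat neg)
  show ?thesis
    by (induction A rule: infinite_finite_induct) (simp_all add: 0 add int)
qed

text \<open>Orthonormality fixes a form on pairs of Schur functions, and these span; expanding one
  argument at a time gives uniqueness.\<close>

lemma scalar_product_eq_schur_form: "scalar_product = schur_form"
  unfolding scalar_product_def
proof (rule the_equality)
  show "symmetric_bilinear schur_form \<and> (\<forall>lam mu. is_partition lam \<longrightarrow> is_partition mu \<longrightarrow>
      schur_form (schur lam) (schur mu) = (if lam = mu then 1 else 0))"
    by (simp add: symmetric_bilinear_schur_form schur_form_schur schur_coeff_schur)
next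
  fix B assume *: "symmetric_bilinear B \<and> (\<forall>lam mu. is_partition lam \<longrightarrow> is_partition mu \<longrightarrow>
      B (schur lam) (schur mu) = (if lam = mu then 1 else 0))"
  then have B: "symmetric_bilinear B" by blast
  have comm: "B f g = B g f" for f g
    using B unfolding symmetric_bilinear_def by blast
  have sB: "B (schur \<alpha>) g = schur_coeff \<alpha> g" if \<alpha>: "is_partition \<alpha>" for \<alpha> g
  proof -
    obtain d where d: "\<And>m. coef g m \<noteq> 0 \<Longrightarrow> mono_degree m \<le> d"
      using symfun_bounded[of g] by blast
    let ?g = "\<Sum>\<nu>\<in>partitions_upto d. of_int (schur_coeff \<nu> g) * schur \<nu>"
    have g: "g = ?g" by (rule schur_coeff_expansion[of g d, OF d])
    have "B ?g (schur \<alpha>) = (\<Sum>\<nu>\<in>partitions_upto d. schur_coeff \<nu> g * schur_coeff \<alpha> (schur \<nu>))"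
      unfolding symmetric_bilinear_lincomb[OF B] using * \<alpha>
      by (intro sum.cong) (auto simp: partitions_upto_def schur_coeff_schur)
    also have "\<dots> = schur_coeff \<alpha> ?g"
      by (simp add: schur_coeff_linear)
    finally show ?thesis using g comm by metis
  qed
  have "B f g = schur_form f g" for f g
  proof -
    obtain d where d: "\<And>m. coef f m \<noteq> 0 \<Longrightarrow> mono_degree m \<le> d"
      using symfun_bounded[of f] by blast
    let ?f = "\<Sum>\<nu>\<in>partitions_upto d. of_int (schur_coeff \<nu> f) * schur \<nu>"
    have f: "f = ?f" by (rule schur_coeff_expansion[of f d, OF d])
    have "B ?f g = schur_form ?f g"
      unfolding symmetric_bilinear_lincomb[OF B] symmetric_bilinear_lincomb[OF symmetric_bilinear_schur_form]
      by (intro sum.cong) (auto simp: sB schur_form_schur partitions_upto_def)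
    then show ?thesis using f by simp
  qed
  then show "B = schur_form" by blast
qed

lemma symmetric_bilinear_scalar_product: "symmetric_bilinear scalar_product"
  by (simp add: scalar_product_eq_schur_form symmetric_bilinear_schur_form)

lemma scalar_product_schur: "is_partition \<alpha> \<Longrightarrow> scalar_product (schur \<alpha>) f = schur_coeff \<alpha> f"
  by (simp add: scalar_product_eq_schur_form schur_form_schur)

section \<open>Complete symmetric functions and the Pieri rule\<close>

lift_definition complete_ps :: "nat \<Rightarrow> power_series" is
  "\<lambda>k m. if mono_degree m = k then 1 else 0" .

lift_definition complete :: "nat \<Rightarrow> symfun" is complete_ps
  by (auto simp: symmetric_ps_def bounded_degree_ps_def complete_ps.rep_eq mono_degree_map_key)

lemma coef_complete: "coef (complete k) m = (if mono_degree m = k then 1 else 0)"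
  by (simp add: complete.rep_eq complete_ps.rep_eq)

lemma complete_0: "complete 0 = 1"
proof (rule symfun_eqI)
  fix m :: monomial
  have "mono_degree m = 0 \<longleftrightarrow> m = 0"
    using card_keys_le[of m] by (auto simp: mono_degree_def)
  then show "coef (complete 0) m = coef 1 m"
    by (simp add: coef_complete coef_1)
qed

text \<open>Carries the sign cancellation of the Pieri rule. Under the interlacing condition the
  matrix is lower triangular with unit diagonal; otherwise it has a zero row or two equal
  rows.\<close>

lemma det_staircase_indicator:
  fixes a b :: "nat \<Rightarrow> nat"
  assumes a: "\<And>i j. i < j \<Longrightarrow> j < n \<Longrightarrow> a j < a i"
    and b: "\<And>i j. i < j \<Longrightarrow> j < n \<Longrightarrow> b j < b i"
  shows "det (mat n n (\<lambda>(i, j). if a i \<le> b j then 1 else 0 :: int)) =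
    (if (\<forall>i<n. a i \<le> b i) \<and> (\<forall>i. Suc i < n \<longrightarrow> b (Suc i) < a i) then 1 else 0)"
    (is "det ?A = _")
proof (cases "(\<forall>i<n. a i \<le> b i) \<and> (\<forall>i. Suc i < n \<longrightarrow> b (Suc i) < a i)")
  case True
  have "det ?A = prod_list (diag_mat ?A)"
  proof (rule det_lower_triangular)
    fix i j :: nat assume ij: "i < j" "j < n"
    \<comment> \<open>The second part of the condition clears the entries just above the diagonal,
      and monotonicity of b clears the rest.\<close>
    then have "b j \<le> b (Suc i)" using b[of "Suc i" j] by (cases "j = Suc i") auto
    also have "b (Suc i) < a i" using True ij by simp
    finally show "?A $$ (i, j) = 0" using ij by simp
  qed simp
  also have "diag_mat ?A = map (\<lambda>_. 1) [0..<n]"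
    unfolding diag_mat_def using True by auto
  finally show ?thesis using True by (simp add: map_replicate_const)
next
  case False
  have "det ?A = 0"
  proof (rule ccontr)
    assume nz: "det ?A \<noteq> 0"
    \<comment> \<open>Row \<open>i\<close> is an initial segment of \<open>t i\<close> ones. As no row vanishes and no two rows agree,
      \<open>t\<close> is positive and strictly increasing, which forces \<open>t i = Suc i\<close>.\<close>
    define t where "t i = card {j. j < n \<and> a i \<le> b j}" for i
    have t: "j < n \<and> a i \<le> b j \<longleftrightarrow> j < t i" for i j
    proof -
      have "{j. j < n \<and> a i \<le> b j} = {..<t i}"
        unfolding t_def
      proof (rule downset_nat_eq)
        fix k j assume j: "j \<in> {j. j < n \<and> a i \<le> b j}" "k \<le> j"
        then show "k \<in> {j. j < n \<and> a i \<le> b j}"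
          using b[of k j] by (cases "k = j") auto
      qed simp
      then show ?thesis by blast
    qed
    have tn: "t i \<le> n" for i
      using t[of "n" i] by (simp add: not_less)
    have t0: "0 < t i" if "i < n" for i
    proof (rule ccontr)
      assume "\<not> 0 < t i"
      then have "\<not> a i \<le> b j" if "j < n" for j using t[of j i] that by simp
      then have "det ?A = 0" using that by (intro det_zero_row[of _ n i]) auto
      with nz show False by simp
    qed
    have lt: "t i < t (Suc i)" if i: "Suc i < n" for i
    proof -
      have "t i \<noteq> t (Suc i)"
      proof
        assume eq: "t i = t (Suc i)"
        have "a i \<le> b j \<longleftrightarrow> a (Suc i) \<le> b j" if "j < n" for j
          using t[of j i] t[of j "Suc i"] that eq by simp
        then have "det ?A = 0"
          using i by (intro det_identical_rows[of _ n i "Suc i"]) (auto intro!: eq_vecI)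
        with nz show False by simp
      qed
      moreover have "k < t (Suc i)" if "k < t i" for k
        using that a[of i "Suc i"] i by (simp flip: t)
      then have "t i \<le> t (Suc i)" by (meson leI less_irrefl)
      ultimately show ?thesis by simp
    qed
    have "t i - 1 = i" if "i < n" for i
    proof (rule strict_mono_on_eq_self[of n "\<lambda>i. t i - 1"])
      show "t i - 1 < t (Suc i) - 1" if "Suc i < n" for i
        using lt[OF that] t0[of i] that by simp
      show "t i - 1 < n" if "i < n" for i
        using t0[OF that] tn[of i] by linarith
    qed (rule that)
    then have ti: "t i = Suc i" if "i < n" for i using t0[OF that] that by fastforce
    have "a i \<le> b i" if "i < n" for i using t[of i i] ti[OF that] by simp
    moreover have "b (Suc i) < a i" if "Suc i < n" for i
      using t[of "Suc i" i] ti[of i] that by simp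
    ultimately show False using False by blast
  qed
  with False show ?thesis by simp
qed

lemma lookup_permuted_monomial:
  assumes "\<sigma> permutes {..<n}" "in_vec n \<alpha>"
  shows "map_key \<sigma> (\<Sum>i<n. single (\<sigma> i) (lookup \<alpha> i)) = \<alpha>"
  using permuted_monomial_eq_iff[OF assms] by blast

text \<open>Each monomial of degree k occurs in h_k with coefficient 1, so only divisibility and
  degrees matter; divisibility then splits over the indices i, as a determinant needs.\<close>

lemma specialise_complete_shift:
  assumes \<sigma>: "\<sigma> permutes {..<n}" and u: "in_vec n u" and v: "in_vec n v"
  shows "lookup (single (\<Sum>i<n. single (\<sigma> i) (lookup u i)) 1 * specialise n (complete k)) v =
    (if (\<forall>i<n. lookup u i \<le> lookup v (\<sigma> i)) \<and> mono_degree v = mono_degree u + k then 1 else 0)"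
proof -
  let ?s = "\<Sum>i<n. single (\<sigma> i) (lookup u i)"
  have s: "map_key \<sigma> ?s = u" by (rule lookup_permuted_monomial[OF \<sigma> u])
  then have ls: "lookup ?s (\<sigma> i) = lookup u i" for i
    by (metis lookup_map_key_perm[OF \<sigma>])
  have deg: "mono_degree ?s = mono_degree u"
    using mono_degree_map_key[OF permutes_bij[OF \<sigma>], of ?s] s by simp
  have u0: "lookup u i = 0" if "\<not> i < n" for i
    using u that by (auto simp: in_vec_def in_keys_iff subset_iff)
  have surj: "(\<forall>j. P j) \<longleftrightarrow> (\<forall>i. P (\<sigma> i))" for P
    using permutes_surj[OF \<sigma>] by (metis surjD)
  have le: "(\<exists>y. v = ?s + y) \<longleftrightarrow> (\<forall>i<n. lookup u i \<le> lookup v (\<sigma> i))"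
    unfolding monomial_le_iff surj[of "\<lambda>j. lookup ?s j \<le> lookup v j"] ls
    using u0 by (metis le0)
  show ?thesis
  proof (cases "\<exists>y. v = ?s + y")
    case True
    then obtain y where y: "v = ?s + y" by blast
    have "keys y \<subseteq> {..<n}" using v unfolding in_vec_def y keys_add_nat by simp
    moreover have "mono_degree v = mono_degree u + mono_degree y"
      using arg_cong[OF y, of mono_degree] deg by (simp add: mono_degree_add)
    ultimately have "lookup (specialise n (complete k)) y = (if mono_degree v = mono_degree u + k then 1 else 0)"
      by (simp add: lookup_specialise coef_complete)
    moreover have "lookup (single ?s 1 * specialise n (complete k)) v = lookup (specialise n (complete k)) y"
      by (subst y) (rule lookup_monom_times)
    ultimately show ?thesis using True le by simp
  next
    case False
    then show ?thesis using le lookup_monom_times_eq_0[of v ?s "specialise n (complete k)"] by auto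
  qed
qed

text \<open>Divisibility is a product over rows, so the signed sum over permutations is a
  determinant of indicators, and its value 0 or 1 expresses that the Pieri rule is multiplicity
  free.\<close>

lemma lookup_alternant_times_complete:
  assumes \<alpha>: "is_partition \<alpha>" "in_vec n \<alpha>" and \<kappa>: "is_partition \<kappa>" "in_vec n \<kappa>"
  shows "lookup (alternant n (staircase n + \<kappa>) * specialise n (complete k)) (staircase n + \<alpha>) =
    (if \<kappa> \<in> hstrips \<alpha> \<and> mono_degree \<alpha> = mono_degree \<kappa> + k then 1 else 0)"
proof -
  let ?u = "staircase n + \<kappa>" and ?v = "staircase n + \<alpha>"
  have uv: "in_vec n ?u" "in_vec n ?v" using \<alpha> \<kappa> by (simp_all add: in_vec_add in_vec_staircase)
  have dec: "lookup (staircase n + \<beta>) j < lookup (staircase n + \<beta>) i"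
    if "is_partition \<beta>" "i < j" "j < n" for \<beta> i j
    using partition_antimono[OF that(1), of i j] that by (simp add: lookup_add lookup_staircase)
  have "lookup (alternant n ?u * specialise n (complete k)) ?v =
    (\<Sum>\<sigma> | \<sigma> permutes {..<n}. sign \<sigma> *
      (if (\<forall>i<n. lookup ?u i \<le> lookup ?v (\<sigma> i)) \<and> mono_degree ?v = mono_degree ?u + k then 1 else 0))"
    unfolding alternant_eq_sum_monoms sum_distrib_right mult.assoc lookup_sum lookup_of_int_mult
    by (rule sum.cong) (simp_all add: specialise_complete_shift[OF _ uv])
  also have "\<dots> = (if mono_degree \<alpha> = mono_degree \<kappa> + k then
      (\<Sum>\<sigma> | \<sigma> permutes {..<n}. sign \<sigma> * (\<Prod>i<n. if lookup ?u i \<le> lookup ?v (\<sigma> i) then 1 else 0)) else 0)"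
  proof -
    have "(\<Prod>i<n. if lookup ?u i \<le> lookup ?v (\<sigma> i) then 1 else 0) =
        (if \<forall>i<n. lookup ?u i \<le> lookup ?v (\<sigma> i) then 1 else 0 :: int)" for \<sigma>
      by (auto intro!: prod.neutral prod_zero)
    then show ?thesis by (simp add: mono_degree_add)
  qed
  also have "(\<Sum>\<sigma> | \<sigma> permutes {..<n}. sign \<sigma> * (\<Prod>i<n. if lookup ?u i \<le> lookup ?v (\<sigma> i) then 1 else 0)) =
      det (mat n n (\<lambda>(i, j). if lookup ?u i \<le> lookup ?v j then 1 else 0))"
    by (subst det_def'[of _ n])
      (auto intro!: sum.cong prod.cong simp: atLeast0LessThan permutes_in_image[of _ "{..<n}", simplified])
  also have "\<dots> = (if (\<forall>i<n. lookup ?u i \<le> lookup ?v i) \<and> (\<forall>i. Suc i < n \<longrightarrow> lookup ?v (Suc i) < lookup ?u i) then 1 else 0)"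
    by (rule det_staircase_indicator) (rule dec[OF \<kappa>(1)] dec[OF \<alpha>(1)]; assumption)+
  also have "(\<forall>i<n. lookup ?u i \<le> lookup ?v i) \<and> (\<forall>i. Suc i < n \<longrightarrow> lookup ?v (Suc i) < lookup ?u i) \<longleftrightarrow>
      \<kappa> \<in> hstrips \<alpha>"
  proof -
    have z: "lookup \<alpha> i = 0" "lookup \<kappa> i = 0" if "\<not> i < n" for i
      using \<alpha>(2) \<kappa>(2) that by (auto simp: in_vec_def in_keys_iff subset_iff)
    have "(\<forall>i<n. lookup ?u i \<le> lookup ?v i) \<longleftrightarrow> (\<forall>i. lookup \<kappa> i \<le> lookup \<alpha> i)"
      using z by (auto simp: lookup_add) (metis le0 not_less)
    \<comment> \<open>Consecutive staircase entries differ by one, which turns \<open><\<close> into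
      \<open>\<le>\<close>; for Suc i \<ge> n both sides hold, as \<alpha> vanishes there.\<close>
    moreover have "(\<forall>i. Suc i < n \<longrightarrow> lookup ?v (Suc i) < lookup ?u i) \<longleftrightarrow> (\<forall>i. lookup \<alpha> (Suc i) \<le> lookup \<kappa> i)"
    proof -
      have "(Suc i < n \<longrightarrow> lookup ?v (Suc i) < lookup ?u i) \<longleftrightarrow> lookup \<alpha> (Suc i) \<le> lookup \<kappa> i" for i
      proof (cases "Suc i < n")
        case True
        then have "lookup (staircase n) i = Suc (lookup (staircase n) (Suc i))"
          by (simp add: lookup_staircase)
        then show ?thesis using True by (simp add: lookup_add less_Suc_eq_le)
      qed (simp add: z)
      then show ?thesis by blast
    qed
    ultimately show ?thesis using \<kappa>(1) by (auto simp: hstrips_def)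
  qed
  finally show ?thesis by simp
qed

lemma hstrips_in_vec:
  assumes "\<kappa> \<in> hstrips \<alpha>" "in_vec n \<alpha>"
  shows "in_vec n \<kappa>"
proof -
  have "keys \<kappa> \<subseteq> keys \<alpha>"
    using assms(1) by (auto simp: hstrips_def in_keys_iff) (metis le_zero_eq neq0_conv)
  then show ?thesis using assms(2) by (auto simp: in_vec_def)
qed

text \<open>The Pieri rule read backwards, for a fixed outer shape. It extends to every f because
  a_\<delta> f is a finite combination of alternants weighted by its coefficients at \<delta> +
  \<kappa>.\<close>

lemma schur_coord_mult_complete:
  assumes \<alpha>: "is_partition \<alpha>" "in_vec n \<alpha>"
  shows "schur_coord n \<alpha> (f * complete k) =
    (\<Sum>\<kappa> | \<kappa> \<in> hstrips \<alpha> \<and> mono_degree \<alpha> = mono_degree \<kappa> + k. schur_coord n \<kappa> f)"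
proof -
  define g where "g = alternant n (staircase n) * specialise n f"
  have g: "alternating n g"
    unfolding g_def by (rule alternating_times_specialise[OF alternating_alternant[OF in_vec_staircase]])
  define K where "K = {\<kappa>. is_partition \<kappa> \<and> in_vec n \<kappa> \<and> lookup g (staircase n + \<kappa>) \<noteq> 0}"
  have "finite ((\<lambda>\<kappa>. staircase n + \<kappa>) -` keys g)"
    by (rule finite_vimageI) (simp_all add: inj_on_def)
  then have K: "finite K"
    by (rule rev_finite_subset) (auto simp: K_def in_keys_iff)
  let ?S = "\<Sum>\<kappa>\<in>K. of_int (lookup g (staircase n + \<kappa>)) * alternant n (staircase n + \<kappa>)"
  have "g - ?S = 0"
  proof (rule alternating_eq_0)
    show "alternating n (g - ?S)"
      using g by (intro alternating_diff alternating_sum alternating_of_int_mult alternating_alternant)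
        (auto simp: K_def in_vec_add in_vec_staircase)
  next
    fix \<nu> assume \<nu>: "is_partition \<nu>" "in_vec n \<nu>"
    have "lookup ?S (staircase n + \<nu>) = (\<Sum>\<kappa>\<in>K. if \<kappa> = \<nu> then lookup g (staircase n + \<kappa>) else 0)"
      unfolding lookup_sum lookup_of_int_mult using \<nu>
      by (intro sum.cong) (auto simp: K_def lookup_alternant_strict)
    also have "\<dots> = lookup g (staircase n + \<nu>)"
      using K \<nu> by (auto simp: K_def)
    finally show "lookup (g - ?S) (staircase n + \<nu>) = 0" by (simp add: lookup_minus)
  qed
  then have gS: "g = ?S" by simp
  have "schur_coord n \<alpha> (f * complete k) = lookup (g * specialise n (complete k)) (staircase n + \<alpha>)"
    by (simp add: schur_coord_def g_def specialise_mult mult.assoc)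
  also have "\<dots> = lookup (?S * specialise n (complete k)) (staircase n + \<alpha>)"
    using gS by simp
  also have "\<dots> = (\<Sum>\<kappa>\<in>K. lookup g (staircase n + \<kappa>) *
      (if \<kappa> \<in> hstrips \<alpha> \<and> mono_degree \<alpha> = mono_degree \<kappa> + k then 1 else 0))"
    unfolding sum_distrib_right mult.assoc lookup_sum lookup_of_int_mult
    by (rule sum.cong) (auto simp: K_def lookup_alternant_times_complete \<alpha>)
  also have "\<dots> = (\<Sum>\<kappa> | \<kappa> \<in> hstrips \<alpha> \<and> mono_degree \<alpha> = mono_degree \<kappa> + k. lookup g (staircase n + \<kappa>))"
  proof (rule sum.mono_neutral_cong)
    show "finite {\<kappa>. \<kappa> \<in> hstrips \<alpha> \<and> mono_degree \<alpha> = mono_degree \<kappa> + k}"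
      using finite_hstrips[of \<alpha>] by (rule rev_finite_subset) auto
    show "lookup g (staircase n + \<kappa>) = 0"
      if "\<kappa> \<in> {\<kappa>. \<kappa> \<in> hstrips \<alpha> \<and> mono_degree \<alpha> = mono_degree \<kappa> + k} - K" for \<kappa>
      using that hstrips_in_vec[OF _ \<alpha>(2)] by (auto simp: K_def hstrips_def)
  qed (use K in auto)
  finally show ?thesis by (simp add: schur_coord_def g_def)
qed

section \<open>Products of complete symmetric functions and coefficient extraction\<close>

definition complete_prod :: "monomial \<Rightarrow> symfun" where
  "complete_prod m = (\<Prod>i\<in>keys m. complete (lookup m i))"

lemma complete_prod_add_single:
  assumes "keys y \<subseteq> {..<n}"
  shows "complete_prod (y + single n l) = complete_prod y * complete l"
proof -
  have sup: "complete_prod m = (\<Prod>i<Suc n. complete (lookup m i))" if "keys m \<subseteq> {..<Suc n}" for m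
    unfolding complete_prod_def using that
    by (intro prod.mono_neutral_left) (auto simp: in_keys_iff complete_0)
  have y0: "lookup y n = 0" using assms by (auto simp: in_keys_iff)
  have "keys (y + single n l) \<subseteq> {..<Suc n}" "keys y \<subseteq> {..<Suc n}"
    using assms by (auto simp: keys_add_nat less_Suc_eq)
  then show ?thesis
    by (simp add: sup y0 complete_0 lookup_add lookup_single)
qed

text \<open>The number N of variables in which coordinates are taken stays fixed; the induction runs
  over the variables of the determinant, each accounting for one factor of
  \<open>complete_prod m\<close>.\<close>

lemma schur_coord_eq_coef_edet:
  assumes \<mu>: "is_partition \<mu>" "lookup \<mu> 0 \<le> r"
    and "is_partition \<alpha>" "lookup \<alpha> 0 \<le> r" "in_vec N \<alpha>" "keys m \<subseteq> {..<n}"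
  shows "schur_coord N \<alpha> (schur \<mu> * complete_prod m) = lookup (specialise n (edet r (sh \<alpha>) (sh \<mu>))) m"
  using assms(3-6)
proof (induction n arbitrary: \<alpha> m)
  case 0
  then have "m = 0" by auto
  then show ?case
    using 0 \<mu> by (simp add: complete_prod_def schur_coord_schur specialise_0_edet_sh)
next
  case (Suc n)
  obtain y where y: "m = y + single n (lookup m n)" "keys y \<subseteq> {..<n}"
    using split_last[OF Suc.prems(4)] .
  let ?l = "lookup m n"
  let ?P = "\<lambda>\<kappa>. specialise n (edet r (sh \<kappa>) (sh \<mu>))"
  have H: "is_partition \<kappa>" "lookup \<kappa> 0 \<le> r" "in_vec N \<kappa>" "mono_degree \<kappa> \<le> mono_degree \<alpha>"
    if "\<kappa> \<in> hstrips \<alpha>" for \<kappa>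
    using that Suc.prems(1-3) hstrips_in_vec[OF that]
    by (auto simp: hstrips_def intro: order_trans mono_degree_mono)
  have "schur_coord N \<alpha> (schur \<mu> * complete_prod m) =
      schur_coord N \<alpha> (schur \<mu> * complete_prod y * complete ?l)"
    by (subst y(1)) (simp add: complete_prod_add_single[OF y(2)] mult.assoc)
  also have "\<dots> = (\<Sum>\<kappa> | \<kappa> \<in> hstrips \<alpha> \<and> mono_degree \<alpha> = mono_degree \<kappa> + ?l. lookup (?P \<kappa>) y)"
    unfolding schur_coord_mult_complete[OF Suc.prems(1,3)]
    using H y(2) by (intro sum.cong) (auto intro!: Suc.IH)
  \<comment> \<open>Fixing the size of the strip on one side amounts to fixing the exponent of the
    last variable on the other; the truncated difference is exact because \<kappa> is contained in
    \<alpha>.\<close>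
  also have "\<dots> = (\<Sum>\<kappa>\<in>hstrips \<alpha>. if mono_degree \<alpha> - mono_degree \<kappa> = ?l then lookup (?P \<kappa>) y else 0)"
    using finite_hstrips[of \<alpha>] H by (intro sum.mono_neutral_cong_left) (auto dest: H(4))
  also have "\<dots> = (\<Sum>\<kappa>\<in>hstrips \<alpha>. lookup (poly_X n ^ (mono_degree \<alpha> - mono_degree \<kappa>) * ?P \<kappa>) (y + single n ?l))"
    by (rule sum.cong) (auto simp: lookup_X_power_times lookup_specialise y(2))
  also have "\<dots> = lookup (specialise (Suc n) (edet r (sh \<alpha>) (sh \<mu>))) (y + single n ?l)"
    by (subst specialise_Suc_edet_sh[OF Suc.prems(1,2) sh_ge]) (simp_all only: lookup_sum)
  finally show ?case using y(1) by simp
qed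

lemma schur_coeff_complete_prod:
  assumes "is_partition \<mu>" "lookup \<mu> 0 \<le> r" "is_partition \<alpha>" "lookup \<alpha> 0 \<le> r"
  shows "schur_coeff \<alpha> (schur \<mu> * complete_prod m) = coef (edet r (sh \<alpha>) (sh \<mu>)) m"
proof -
  obtain n where "keys m \<subseteq> {..<n}"
    using finite_nat_iff_bounded[of "keys m"] by auto
  then show ?thesis
    unfolding schur_coeff_def using assms
    by (subst schur_coord_eq_coef_edet) (auto simp: lookup_specialise partition_in_vec)
qed

lemma schur_0: "schur 0 = 1"
  using schur_eq_edet[OF is_partition_0, of 0] by (simp add: edet_def)

text \<open>Also yields nondegeneracy: the pairings with all \<open>complete_prod m\<close>
  determine f.\<close>

lemma scalar_product_complete_prod: "scalar_product f (complete_prod m) = coef f m"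
proof -
  obtain d where d: "\<And>m. coef f m \<noteq> 0 \<Longrightarrow> mono_degree m \<le> d"
    using symfun_bounded[of f] by blast
  let ?f = "\<Sum>\<nu>\<in>partitions_upto d. of_int (schur_coeff \<nu> f) * schur \<nu>"
  have "schur_coeff \<nu> (complete_prod m) = coef (schur \<nu>) m" if "is_partition \<nu>" for \<nu>
    using schur_coeff_complete_prod[OF is_partition_0 _ that order_refl, of m]
      schur_eq_edet[OF that order_refl] by (simp add: schur_0)
  then have "scalar_product ?f (complete_prod m) = coef ?f m"
    unfolding symmetric_bilinear_lincomb[OF symmetric_bilinear_scalar_product] coef_sum coef_of_int_mult
    by (intro sum.cong) (auto simp: scalar_product_schur partitions_upto_def)
  then show ?thesis using schur_coeff_expansion[of f d, OF d] by simp
qed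

text \<open>So far the formula is known for f = h_m. Instead of expanding f in such products, the
  functional is first represented by an explicit combination \<open>R\<close> of Schur functions;
  pairing with h_m then shows that \<open>R\<close> and the determinant have the same
  coefficients.\<close>

lemma scalar_product_edet:
  assumes \<alpha>: "is_partition \<alpha>" "lookup \<alpha> 0 \<le> r" and \<mu>: "is_partition \<mu>" "lookup \<mu> 0 \<le> r"
  shows "scalar_product (edet r (sh \<alpha>) (sh \<mu>)) f = schur_coeff \<alpha> (schur \<mu> * f)"
proof -
  let ?L = "\<lambda>f. schur_coeff \<alpha> (schur \<mu> * f)"
  let ?F = "partitions_upto (mono_degree \<alpha>)"
  \<comment> \<open>By homogeneity the functional vanishes on \<open>schur \<nu>\<close> unless
    |\<nu>| \<le> |\<alpha>|, so this finite sum over the orthonormal basis represents it.\<close>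
  define R where "R = (\<Sum>\<nu>\<in>?F. of_int (?L (schur \<nu>)) * schur \<nu>)"
  have comm: "scalar_product f g = scalar_product g f" for f g
    using symmetric_bilinear_scalar_product unfolding symmetric_bilinear_def by blast
  have R_schur: "scalar_product (schur \<nu>) R = ?L (schur \<nu>)" if \<nu>: "is_partition \<nu>" for \<nu>
  proof -
    have "scalar_product (schur \<nu>) R = (\<Sum>\<kappa>\<in>?F. if \<nu> = \<kappa> then ?L (schur \<kappa>) else 0)"
      unfolding scalar_product_schur[OF \<nu>] R_def schur_coeff_linear
      by (rule sum.cong) (auto simp: schur_coeff_schur \<nu> partitions_upto_def)
    also have "\<dots> = (if \<nu> \<in> ?F then ?L (schur \<nu>) else 0)"
      by (simp add: finite_partitions_upto)
    also have "\<dots> = ?L (schur \<nu>)"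
    proof -
      have "\<nu> \<in> ?F" if "?L (schur \<nu>) \<noteq> 0"
      proof -
        obtain m where "coef (schur \<mu> * schur \<nu>) m \<noteq> 0" "mono_degree m = mono_degree \<alpha>"
          using \<open>?L (schur \<nu>) \<noteq> 0\<close> by (rule schur_coeff_nonzero)
        then show ?thesis
          using homogeneous_mult[OF homogeneous_schur[OF \<mu>(1)] homogeneous_schur[OF \<nu>]] \<nu>
          by (auto simp: homogeneous_def partitions_upto_def)
      qed
      then show ?thesis by auto
    qed
    finally show ?thesis .
  qed
  have R: "scalar_product R f = ?L f" for f
  proof -
    obtain d where d: "\<And>m. coef f m \<noteq> 0 \<Longrightarrow> mono_degree m \<le> d"
      using symfun_bounded[of f] by blast
    let ?f = "\<Sum>\<nu>\<in>partitions_upto d. of_int (schur_coeff \<nu> f) * schur \<nu>"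
    have "scalar_product ?f R = (\<Sum>\<nu>\<in>partitions_upto d. schur_coeff \<nu> f * ?L (schur \<nu>))"
      unfolding symmetric_bilinear_lincomb[OF symmetric_bilinear_scalar_product]
      by (rule sum.cong) (auto simp: R_schur partitions_upto_def)
    also have "\<dots> = ?L ?f"
      by (simp add: sum_distrib_left mult.left_commute[of _ "of_int _"] schur_coeff_linear)
    finally show ?thesis
      using schur_coeff_expansion[of f d, OF d] comm[of R f] by simp
  qed
  have "R = edet r (sh \<alpha>) (sh \<mu>)"
    by (rule symfun_eqI)
      (simp add: R schur_coeff_complete_prod[OF \<mu> \<alpha>] flip: scalar_product_complete_prod[of R])
  then show ?thesis using R by simp
qed

lemma skew_schur_eq_edet:
  assumes \<alpha>: "is_partition \<alpha>" "lookup \<alpha> 0 \<le> r" and \<mu>: "is_partition \<mu>" "lookup \<mu> 0 \<le> r"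
  shows "skew_schur \<alpha> \<mu> = edet r (sh \<alpha>) (sh \<mu>)"
  unfolding skew_schur_def
proof (rule the_equality)
  show "\<forall>f. scalar_product (edet r (sh \<alpha>) (sh \<mu>)) f = scalar_product (schur \<alpha>) (schur \<mu> * f)"
    by (simp add: scalar_product_edet assms scalar_product_schur)
next
  fix s assume "\<forall>f. scalar_product s f = scalar_product (schur \<alpha>) (schur \<mu> * f)"
  \<comment> \<open>Pairing with \<open>complete_prod m\<close> reads off the coefficient of s at m,
    so the defining property leaves no freedom.\<close>
  then show "s = edet r (sh \<alpha>) (sh \<mu>)"
    by (intro symfun_eqI) (simp add: scalar_product_edet[OF assms] scalar_product_schur \<alpha>
        flip: scalar_product_complete_prod)
qed

theorem mainTheorem9:
  fixes lam mu :: composition and r :: nat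
  assumes "is_partition lam" and "is_partition mu"
    and "\<forall>i. Poly_Mapping.lookup mu i \<le> Poly_Mapping.lookup lam i"
    and "Poly_Mapping.lookup lam 0 \<le> r"
  shows "skew_schur lam mu =
    det (mat r r (\<lambda>(i, j).
      elementary (shifted_entry (transpose_part lam) i - shifted_entry (transpose_part mu) j)))"
  \<comment> \<open>Containment gives \<mu>_0 \<le> \<lambda>_0 \<le> r, so both shapes fit into r
    columns.\<close>
  using skew_schur_eq_edet[OF assms(1,4,2) order_trans[OF assms(3)[rule_format] assms(4)]]
  unfolding edet_def .

end
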